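(* Let $(G,m,u,\iota)$ be a group object in a Cartesian tangent category such that the pullback $T(G)_u$ of $p_G:T(G)\to G$ along $u:1\to G$ exists, and let $\phi^{-1}=(0\times p_u^* )T(m):G\times T(G)_u\to T(G)$ (an isomorphism). Then the following squares commute, their vertical arrows being isomorphisms: (1) with vertical arrows $\langle\langle\pi_0,\pi_1\rangle\phi^{-1},\langle\pi_0,\pi_2\rangle\phi^{-1}\rangle:G\times T(G)_u\times T(G)_u\to T_2(G)$ and $\phi^{-1}$: $$\langle\langle\pi_0,\pi_1\rangle\phi^{-1},\langle\pi_0,\pi_2\rangle\phi^{-1}\rangle\,+=(1_G\times+_u)\,\phi^{-1}:G\times T(G)_u\times T(G)_u\to T(G);$$ (2) with vertical arrows $1_G$ and $\phi^{-1}$: $\ 0_G=\langle1_G,!0_u\rangle\phi^{-1}:G\to T(G)$; (3) with vertical arrows $\phi^{-1}$ and $1_G$: $\ \phi^{-1}p=\pi_0:G\times T(G)_u\to G$; (4) with vertical arrows $0_1:1\to T(1)$ and $\phi^{-1}$: $\ 0_1T(u)=\langle u,0_u\rangle\phi^{-1}:1\to T(G)$.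
   Context: Composition is written in diagrammatic order: $fg$ means first $f$, then $g$. Tangent category $(\mathbb X,T,p,0,+,\ell,c)$: a category $\mathbb X$ with a functor $T:\mathbb X\to\mathbb X$ and a natural transformation $p:T\to 1$ such that the pullback powers $T_n(M)$ of $p_M$ ($n$-fold fibre products of $T(M)$ over $M$) exist for all objects $M$ and are preserved by $T$; natural transformations $+:T_2\to T$, $0:1\to T$ making each $p_M$ an additive bundle (a commutative monoid over $M$: $+p=\pi_0p=\pi_1p$, $0p=1$, $+$ associative, commutative, with unit $0$); a natural transformation $\ell:T\to T^2$ such that $(\ell_M,0_M):(p_M,+_M,0_M)\to(T(p_M),T(+_M),T(0_M))$ is an additive bundle morphism (commutes with projections, additions and zeros); a natural transformation $c:T^2\to T^2$ with $c^2=1$, $\ell c=\ell$ such that $(c_M,1):(T(p_M),T(+_M),T(0_M))\to(p_{TM},+_{TM},0_{TM})$ is an additive bundle morphism; such that $\ell T(\ell)=\ell\,\ell_T$, $T(c)\,c_T\,T(c)=c_T\,T(c)\,c_T$, $\ell_T\,T(c)\,c_T=c\,T(\ell)$, and $\langle\pi_0\ell,\pi_1 0_T\rangle T(+):T_2M\to T^2M$ is the equalizer of $T(p)$ and $T(p)p0:T^2M\to TM$. Cartesian tangent category: a tangent category with all finite products (terminal object $1$) such that the product functor, with the natural isomorphism $T(A)\times T(B)\cong T(A\times B)$, is a strong morphism of tangent categories (the canonical comparison maps are isomorphisms compatible with $p,0,+,\ell,c$). These identifications are suppressed, so e.g. $T(m):T(G)\times T(G)\to T(G)$. $!$ is the unique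 map to $1$; $f\times g=\langle\pi_0f,\pi_1g\rangle$; $p_u^*:T(G)_u\to T(G)$ is the pullback projection; for $h:X\to T(G)$ with $hp=!u$, $\langle !,h\rangle:X\to T(G)_u$ is the unique map with $\langle !,h\rangle p_u^*=h$. $0_u:=\langle !,u0_G\rangle:1\to T(G)_u$ and $+_u:=\langle !,\langle\pi_0p_u^*,\pi_1p_u^*\rangle+\rangle:T(G)_u\times T(G)_u\to T(G)_u$. *)

theory Defs
  imports Main
begin

section \<open>Categories, with composition in diagrammatic order\<close>

record ('o, 'a) category =
  Ob :: "'o set"
  Ar :: "'a set"
  src :: "'a \<Rightarrow> 'o"
  tgt :: "'a \<Rightarrow> 'o"
  ident :: "'o \<Rightarrow> 'a"  ("\<one>\<index>")
  comp :: "'a \<Rightarrow> 'a \<Rightarrow> 'a"  (infixl "\<cdot>\<index>" 70)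

definition hom :: "('o, 'a, 'x) category_scheme \<Rightarrow> 'o \<Rightarrow> 'o \<Rightarrow> 'a set" where
  "hom X A B = {f \<in> Ar X. src X f = A \<and> tgt X f = B}"

locale category =
  fixes X :: "('o, 'a, 'x) category_scheme" (structure)
  assumes src_ob: "f \<in> Ar X \<Longrightarrow> src X f \<in> Ob X"
    and tgt_ob: "f \<in> Ar X \<Longrightarrow> tgt X f \<in> Ob X"
    and ident_hom: "A \<in> Ob X \<Longrightarrow> \<one> A \<in> hom X A A"
    and comp_hom: "f \<in> hom X A B \<Longrightarrow> g \<in> hom X B C \<Longrightarrow> f \<cdot> g \<in> hom X A C"
    and ident_comp: "f \<in> hom X A B \<Longrightarrow> \<one> A \<cdot> f = f"
    and comp_ident: "f \<in> hom X A B \<Longrightarrow> f \<cdot> \<one> B = f"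
    and comp_assoc: "f \<in> hom X A B \<Longrightarrow> g \<in> hom X B C \<Longrightarrow> h \<in> hom X C D \<Longrightarrow>
      (f \<cdot> g) \<cdot> h = f \<cdot> (g \<cdot> h)"

definition inverse_arrows :: "('o, 'a, 'x) category_scheme \<Rightarrow> 'a \<Rightarrow> 'a \<Rightarrow> bool" where
  "inverse_arrows X f g \<longleftrightarrow>
     f \<in> Ar X \<and> g \<in> hom X (tgt X f) (src X f) \<and>
     comp X f g = ident X (src X f) \<and> comp X g f = ident X (tgt X f)"

definition is_iso :: "('o, 'a, 'x) category_scheme \<Rightarrow> 'a \<Rightarrow> bool" where
  "is_iso X f \<longleftrightarrow> (\<exists>g. inverse_arrows X f g)"

definition inverse_of :: "('o, 'a, 'x) category_scheme \<Rightarrow> 'a \<Rightarrow> 'a" where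
  "inverse_of X f = (THE g. inverse_arrows X f g)"

text \<open>
  The square with top \<open>f : A \<rightarrow> B\<close>, left \<open>l : A \<rightarrow> C\<close>, right \<open>r : B \<rightarrow> D\<close> and
  bottom \<open>g : C \<rightarrow> D\<close>.
\<close>

definition commutative_square ::
  "('o, 'a, 'x) category_scheme \<Rightarrow> 'o \<Rightarrow> 'o \<Rightarrow> 'o \<Rightarrow> 'o \<Rightarrow> 'a \<Rightarrow> 'a \<Rightarrow> 'a \<Rightarrow> 'a \<Rightarrow> bool" where
  "commutative_square X A B C D f l r g \<longleftrightarrow>
     f \<in> hom X A B \<and> l \<in> hom X A C \<and> r \<in> hom X B D \<and> g \<in> hom X C D \<and>
     comp X f r = comp X l g"

definition endofunctor ::
  "('o, 'a, 'x) category_scheme \<Rightarrow> ('o \<Rightarrow> 'o) \<Rightarrow> ('a \<Rightarrow> 'a) \<Rightarrow> bool" where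
  "endofunctor X Fo Fa \<longleftrightarrow>
     (\<forall>A\<in>Ob X. Fo A \<in> Ob X) \<and>
     (\<forall>A B. \<forall>f\<in>hom X A B. Fa f \<in> hom X (Fo A) (Fo B)) \<and>
     (\<forall>A\<in>Ob X. Fa (ident X A) = ident X (Fo A)) \<and>
     (\<forall>A B C. \<forall>f\<in>hom X A B. \<forall>g\<in>hom X B C. Fa (comp X f g) = comp X (Fa f) (Fa g))"

definition nat_trans ::
  "('o, 'a, 'x) category_scheme \<Rightarrow> ('o \<Rightarrow> 'o) \<Rightarrow> ('a \<Rightarrow> 'a) \<Rightarrow> ('o \<Rightarrow> 'o) \<Rightarrow> ('a \<Rightarrow> 'a) \<Rightarrow>
    ('o \<Rightarrow> 'a) \<Rightarrow> bool" where
  "nat_trans X Fo Fa Go Ga \<eta> \<longleftrightarrow>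
     (\<forall>A\<in>Ob X. \<eta> A \<in> hom X (Fo A) (Go A)) \<and>
     (\<forall>A B. \<forall>f\<in>hom X A B. comp X (Fa f) (\<eta> B) = comp X (\<eta> A) (Ga f))"


section \<open>Limits\<close>

definition is_terminal :: "('o, 'a, 'x) category_scheme \<Rightarrow> 'o \<Rightarrow> bool" where
  "is_terminal X I \<longleftrightarrow> I \<in> Ob X \<and> (\<forall>A\<in>Ob X. \<exists>!h. h \<in> hom X A I)"

definition is_product ::
  "('o, 'a, 'x) category_scheme \<Rightarrow> 'o \<Rightarrow> 'o \<Rightarrow> 'o \<Rightarrow> 'a \<Rightarrow> 'a \<Rightarrow> bool" where
  "is_product X A B P a b \<longleftrightarrow>
     a \<in> hom X P A \<and> b \<in> hom X P B \<and>
     (\<forall>Y f g. f \<in> hom X Y A \<and> g \<in> hom X Y B \<longrightarrow>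
        (\<exists>!h. h \<in> hom X Y P \<and> comp X h a = f \<and> comp X h b = g))"

definition is_pullback ::
  "('o, 'a, 'x) category_scheme \<Rightarrow> 'a \<Rightarrow> 'a \<Rightarrow> 'o \<Rightarrow> 'a \<Rightarrow> 'a \<Rightarrow> bool" where
  "is_pullback X s t P a b \<longleftrightarrow>
     s \<in> Ar X \<and> t \<in> Ar X \<and> tgt X s = tgt X t \<and>
     a \<in> hom X P (src X s) \<and> b \<in> hom X P (src X t) \<and> comp X a s = comp X b t \<and>
     (\<forall>Y f g. f \<in> hom X Y (src X s) \<and> g \<in> hom X Y (src X t) \<and> comp X f s = comp X g t \<longrightarrow>
        (\<exists>!h. h \<in> hom X Y P \<and> comp X h a = f \<and> comp X h b = g))"

text \<open>
  The \<open>n\<close>-fold fibre product of \<open>q : E \<rightarrow> M\<close> over \<open>M\<close>.  The structure map \<open>r : P \<rightarrow> M\<close> is part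
  of the cone, so that \<open>n = 0\<close> is covered as well (giving \<open>M\<close> itself).
\<close>

definition is_fibre_power ::
  "('o, 'a, 'x) category_scheme \<Rightarrow> nat \<Rightarrow> 'a \<Rightarrow> 'o \<Rightarrow> 'a \<Rightarrow> (nat \<Rightarrow> 'a) \<Rightarrow> bool" where
  "is_fibre_power X n q P r \<pi> \<longleftrightarrow>
     q \<in> Ar X \<and> r \<in> hom X P (tgt X q) \<and>
     (\<forall>i<n. \<pi> i \<in> hom X P (src X q) \<and> comp X (\<pi> i) q = r) \<and>
     (\<forall>Y s f. s \<in> hom X Y (tgt X q) \<and>
        (\<forall>i<n. f i \<in> hom X Y (src X q) \<and> comp X (f i) q = s) \<longrightarrow>
        (\<exists>!h. h \<in> hom X Y P \<and> comp X h r = s \<and> (\<forall>i<n. comp X h (\<pi> i) = f i)))"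

definition is_equalizer ::
  "('o, 'a, 'x) category_scheme \<Rightarrow> 'a \<Rightarrow> 'a \<Rightarrow> 'a \<Rightarrow> bool" where
  "is_equalizer X e f g \<longleftrightarrow>
     f \<in> Ar X \<and> g \<in> hom X (src X f) (tgt X f) \<and> e \<in> Ar X \<and> tgt X e = src X f \<and>
     comp X e f = comp X e g \<and>
     (\<forall>Y k. k \<in> hom X Y (src X f) \<and> comp X k f = comp X k g \<longrightarrow>
        (\<exists>!h. h \<in> hom X Y (src X e) \<and> comp X h e = k))"

text \<open>
  The map \<open>\<langle>f, g\<rangle>\<close> into the apex \<open>P\<close> of a span \<open>a, b\<close>; used for products and for fibre products.
\<close>

definition span_pair ::
  "('o, 'a, 'x) category_scheme \<Rightarrow> 'o \<Rightarrow> 'a \<Rightarrow> 'a \<Rightarrow> 'a \<Rightarrow> 'a \<Rightarrow> 'a" where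
  "span_pair X P a b f g =
     (THE h. h \<in> hom X (src X f) P \<and> comp X h a = f \<and> comp X h b = g)"


section \<open>Additive bundles\<close>

text \<open>
  The data of a bundle \<open>q : E \<rightarrow> M\<close> with a fibre square \<open>E\<^sub>2\<close>, its projections, an addition
  \<open>E\<^sub>2 \<rightarrow> E\<close> and a zero section \<open>M \<rightarrow> E\<close>.
\<close>

record ('o, 'a) bundle_data =
  bproj :: 'a
  bsq :: 'o
  bfst :: 'a
  bsnd :: 'a
  badd :: 'a
  bzero :: 'a

definition bpair :: "('o, 'a, 'x) category_scheme \<Rightarrow> ('o, 'a) bundle_data \<Rightarrow> 'a \<Rightarrow> 'a \<Rightarrow> 'a" where
  "bpair X B f g = span_pair X (bsq B) (bfst B) (bsnd B) f g"

definition additive_bundle :: "('o, 'a, 'x) category_scheme \<Rightarrow> ('o, 'a) bundle_data \<Rightarrow> bool" where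
  "additive_bundle X B \<longleftrightarrow>
     (let q = bproj B; E = src X q; M = tgt X q; cmp = comp X in
       is_pullback X q q (bsq B) (bfst B) (bsnd B) \<and>
       badd B \<in> hom X (bsq B) E \<and> bzero B \<in> hom X M E \<and>
       cmp (badd B) q = cmp (bfst B) q \<and> cmp (badd B) q = cmp (bsnd B) q \<and>
       cmp (bzero B) q = ident X M \<and>
       (\<exists>P r \<pi>. is_fibre_power X 3 q P r \<pi>) \<and>
       (\<forall>P r \<pi>. is_fibre_power X 3 q P r \<pi> \<longrightarrow>
          cmp (bpair X B (cmp (bpair X B (\<pi> 0) (\<pi> 1)) (badd B)) (\<pi> 2)) (badd B) =
          cmp (bpair X B (\<pi> 0) (cmp (bpair X B (\<pi> 1) (\<pi> 2)) (badd B))) (badd B)) \<and>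
       cmp (bpair X B (bsnd B) (bfst B)) (badd B) = badd B \<and>
       cmp (bpair X B (cmp q (bzero B)) (ident X E)) (badd B) = ident X E \<and>
       cmp (bpair X B (ident X E) (cmp q (bzero B))) (badd B) = ident X E)"

definition additive_bundle_morphism ::
  "('o, 'a, 'x) category_scheme \<Rightarrow> 'a \<Rightarrow> 'a \<Rightarrow> ('o, 'a) bundle_data \<Rightarrow> ('o, 'a) bundle_data \<Rightarrow> bool" where
  "additive_bundle_morphism X f g B B' \<longleftrightarrow>
     f \<in> hom X (src X (bproj B)) (src X (bproj B')) \<and>
     g \<in> hom X (tgt X (bproj B)) (tgt X (bproj B')) \<and>
     comp X f (bproj B') = comp X (bproj B) g \<and>
     comp X (bpair X B' (comp X (bfst B) f) (comp X (bsnd B) f)) (badd B') = comp X (badd B) f \<and>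
     comp X g (bzero B') = comp X (bzero B) f"


section \<open>Tangent categories\<close>

text \<open>
  \<open>\<T>\<^sub>o\<close> and \<open>\<T>\<^sub>a\<close> are the tangent functor on objects and arrows; \<open>\<T>\<^sub>2\<close> with \<open>\<pi>\<^sub>0\<close>, \<open>\<pi>\<^sub>1\<close> is a choice
  of fibre squares of the projections \<open>\<p> M : T M \<rightarrow> M\<close>; \<open>\<oplus>\<close>, \<open>\<zero>\<close>, \<open>\<ell>\<close>, \<open>\<c>\<close> are the remaining
  structure transformations.
\<close>

record ('o, 'a) tangent_category = "('o, 'a) category" +
  Tob :: "'o \<Rightarrow> 'o"  ("\<T>\<^sub>o\<index>")
  Tar :: "'a \<Rightarrow> 'a"  ("\<T>\<^sub>a\<index>")
  tproj :: "'o \<Rightarrow> 'a"  ("\<p>\<index>")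
  Tsq :: "'o \<Rightarrow> 'o"  ("\<T>\<^sub>2\<index>")
  tfst :: "'o \<Rightarrow> 'a"  ("\<pi>\<^sub>0\<index>")
  tsnd :: "'o \<Rightarrow> 'a"  ("\<pi>\<^sub>1\<index>")
  tadd :: "'o \<Rightarrow> 'a"  ("\<oplus>\<index>")
  tzero :: "'o \<Rightarrow> 'a"  ("\<zero>\<index>")
  tlift :: "'o \<Rightarrow> 'a"  ("\<ell>\<index>")
  tflip :: "'o \<Rightarrow> 'a"  ("\<c>\<index>")

definition tbundle :: "('o, 'a, 'x) tangent_category_scheme \<Rightarrow> 'o \<Rightarrow> ('o, 'a) bundle_data" where
  "tbundle X M =
     \<lparr>bproj = tproj X M, bsq = Tsq X M, bfst = tfst X M, bsnd = tsnd X M,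
      badd = tadd X M, bzero = tzero X M\<rparr>"

definition Tbundle ::
  "('o, 'a, 'x) tangent_category_scheme \<Rightarrow> ('o, 'a) bundle_data \<Rightarrow> ('o, 'a) bundle_data" where
  "Tbundle X B =
     \<lparr>bproj = Tar X (bproj B), bsq = Tob X (bsq B), bfst = Tar X (bfst B), bsnd = Tar X (bsnd B),
      badd = Tar X (badd B), bzero = Tar X (bzero B)\<rparr>"

definition Tsq_ar :: "('o, 'a, 'x) tangent_category_scheme \<Rightarrow> 'a \<Rightarrow> 'a" where
  "Tsq_ar X f =
     bpair X (tbundle X (tgt X f))
       (comp X (tfst X (src X f)) (Tar X f)) (comp X (tsnd X (src X f)) (Tar X f))"

locale tangent_category = category X
  for X :: "('o, 'a, 'x) tangent_category_scheme" (structure) +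
  assumes T_functor: "endofunctor X \<T>\<^sub>o \<T>\<^sub>a"
    and p_nat: "nat_trans X \<T>\<^sub>o \<T>\<^sub>a (\<lambda>A. A) (\<lambda>f. f) \<p>"
    and powers_exist: "M \<in> Ob X \<Longrightarrow> \<exists>P r \<pi>. is_fibre_power X n (\<p> M) P r \<pi>"
    and powers_preserved: "M \<in> Ob X \<Longrightarrow> is_fibre_power X n (\<p> M) P r \<pi> \<Longrightarrow>
      is_fibre_power X n (\<T>\<^sub>a (\<p> M)) (\<T>\<^sub>o P) (\<T>\<^sub>a r) (\<lambda>i. \<T>\<^sub>a (\<pi> i))"
    and Tsq_pullback: "M \<in> Ob X \<Longrightarrow> is_pullback X (\<p> M) (\<p> M) (\<T>\<^sub>2 M) (\<pi>\<^sub>0 M) (\<pi>\<^sub>1 M)"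
    and add_nat: "nat_trans X \<T>\<^sub>2 (Tsq_ar X) \<T>\<^sub>o \<T>\<^sub>a \<oplus>"
    and zero_nat: "nat_trans X (\<lambda>A. A) (\<lambda>f. f) \<T>\<^sub>o \<T>\<^sub>a \<zero>"
    and additive: "M \<in> Ob X \<Longrightarrow> additive_bundle X (tbundle X M)"
    and lift_nat: "nat_trans X \<T>\<^sub>o \<T>\<^sub>a (\<lambda>A. \<T>\<^sub>o (\<T>\<^sub>o A)) (\<lambda>f. \<T>\<^sub>a (\<T>\<^sub>a f)) \<ell>"
    and lift_additive: "M \<in> Ob X \<Longrightarrow>
      additive_bundle_morphism X (\<ell> M) (\<zero> M) (tbundle X M) (Tbundle X (tbundle X M))"
    and flip_nat: "nat_trans X (\<lambda>A. \<T>\<^sub>o (\<T>\<^sub>o A)) (\<lambda>f. \<T>\<^sub>a (\<T>\<^sub>a f))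
      (\<lambda>A. \<T>\<^sub>o (\<T>\<^sub>o A)) (\<lambda>f. \<T>\<^sub>a (\<T>\<^sub>a f)) \<c>"
    and flip_flip: "M \<in> Ob X \<Longrightarrow> \<c> M \<cdot> \<c> M = \<one> (\<T>\<^sub>o (\<T>\<^sub>o M))"
    and lift_flip: "M \<in> Ob X \<Longrightarrow> \<ell> M \<cdot> \<c> M = \<ell> M"
    and flip_additive: "M \<in> Ob X \<Longrightarrow>
      additive_bundle_morphism X (\<c> M) (\<one> (\<T>\<^sub>o M)) (Tbundle X (tbundle X M)) (tbundle X (\<T>\<^sub>o M))"
    and lift_coassoc: "M \<in> Ob X \<Longrightarrow> \<ell> M \<cdot> \<T>\<^sub>a (\<ell> M) = \<ell> M \<cdot> \<ell> (\<T>\<^sub>o M)"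
    and flip_braid: "M \<in> Ob X \<Longrightarrow>
      \<T>\<^sub>a (\<c> M) \<cdot> \<c> (\<T>\<^sub>o M) \<cdot> \<T>\<^sub>a (\<c> M) = \<c> (\<T>\<^sub>o M) \<cdot> \<T>\<^sub>a (\<c> M) \<cdot> \<c> (\<T>\<^sub>o M)"
    and lift_flip_braid: "M \<in> Ob X \<Longrightarrow>
      \<ell> (\<T>\<^sub>o M) \<cdot> \<T>\<^sub>a (\<c> M) \<cdot> \<c> (\<T>\<^sub>o M) = \<c> M \<cdot> \<T>\<^sub>a (\<ell> M)"
    and lift_universal: "M \<in> Ob X \<Longrightarrow>
      is_equalizer X
        (bpair X (Tbundle X (tbundle X M)) (\<pi>\<^sub>0 M \<cdot> \<ell> M) (\<pi>\<^sub>1 M \<cdot> \<zero> (\<T>\<^sub>o M)) \<cdot> \<T>\<^sub>a (\<oplus> M))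
        (\<T>\<^sub>a (\<p> M))
        (\<T>\<^sub>a (\<p> M) \<cdot> \<p> M \<cdot> \<zero> M)"


section \<open>Cartesian tangent categories\<close>

record ('o, 'a) cartesian_tangent_category = "('o, 'a) tangent_category" +
  terminal :: 'o  ("\<I>\<index>")
  Prod :: "'o \<Rightarrow> 'o \<Rightarrow> 'o"  (infixr "\<Otimes>\<index>" 75)
  pfst :: "'o \<Rightarrow> 'o \<Rightarrow> 'a"
  psnd :: "'o \<Rightarrow> 'o \<Rightarrow> 'a"

definition bang :: "('o, 'a, 'x) cartesian_tangent_category_scheme \<Rightarrow> 'o \<Rightarrow> 'a"  ("!\<index>") where
  "bang X A = (THE h. h \<in> hom X A (terminal X))"

definition pair :: "('o, 'a, 'x) cartesian_tangent_category_scheme \<Rightarrow> 'a \<Rightarrow> 'a \<Rightarrow> 'a"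
    ("\<langle>_, _\<rangle>\<index>") where
  "pair X f g =
     span_pair X (Prod X (tgt X f) (tgt X g))
       (pfst X (tgt X f) (tgt X g)) (psnd X (tgt X f) (tgt X g)) f g"

definition cross :: "('o, 'a, 'x) cartesian_tangent_category_scheme \<Rightarrow> 'a \<Rightarrow> 'a \<Rightarrow> 'a"
    (infixr "\<otimes>\<index>" 75) where
  "cross X f g =
     pair X (comp X (pfst X (src X f) (src X g)) f) (comp X (psnd X (src X f) (src X g)) g)"

text \<open>
  The isomorphism \<open>T A \<times> T B \<rightarrow> T (A \<times> B)\<close>, inverse to the canonical comparison map.
\<close>

definition Tprod_iso :: "('o, 'a, 'x) cartesian_tangent_category_scheme \<Rightarrow> 'o \<Rightarrow> 'o \<Rightarrow> 'a"
    ("\<alpha>\<index>") where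
  "Tprod_iso X A B = inverse_of X (pair X (Tar X (pfst X A B)) (Tar X (psnd X A B)))"

locale cartesian_tangent_category = tangent_category X
  for X :: "('o, 'a, 'x) cartesian_tangent_category_scheme" (structure) +
  assumes terminal: "is_terminal X \<I>"
    and product: "A \<in> Ob X \<Longrightarrow> B \<in> Ob X \<Longrightarrow>
      is_product X A B (A \<Otimes> B) (pfst X A B) (psnd X A B)"
    and comparison_iso: "A \<in> Ob X \<Longrightarrow> B \<in> Ob X \<Longrightarrow>
      is_iso X \<langle>\<T>\<^sub>a (pfst X A B), \<T>\<^sub>a (psnd X A B)\<rangle>"
    and Tprod_nat: "f \<in> hom X A A' \<Longrightarrow> g \<in> hom X B B' \<Longrightarrow>
      (\<T>\<^sub>a f \<otimes> \<T>\<^sub>a g) \<cdot> \<alpha> A' B' = \<alpha> A B \<cdot> \<T>\<^sub>a (f \<otimes> g)"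
    and Tprod_proj: "A \<in> Ob X \<Longrightarrow> B \<in> Ob X \<Longrightarrow>
      \<alpha> A B \<cdot> \<p> (A \<Otimes> B) = \<p> A \<otimes> \<p> B"
    and Tprod_zero: "A \<in> Ob X \<Longrightarrow> B \<in> Ob X \<Longrightarrow>
      (\<zero> A \<otimes> \<zero> B) \<cdot> \<alpha> A B = \<zero> (A \<Otimes> B)"
    and Tprod_add: "A \<in> Ob X \<Longrightarrow> B \<in> Ob X \<Longrightarrow>
      (\<oplus> A \<otimes> \<oplus> B) \<cdot> \<alpha> A B =
      bpair X (tbundle X (A \<Otimes> B)) ((\<pi>\<^sub>0 A \<otimes> \<pi>\<^sub>0 B) \<cdot> \<alpha> A B) ((\<pi>\<^sub>1 A \<otimes> \<pi>\<^sub>1 B) \<cdot> \<alpha> A B) \<cdot>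
        \<oplus> (A \<Otimes> B)"
    and Tprod_lift: "A \<in> Ob X \<Longrightarrow> B \<in> Ob X \<Longrightarrow>
      (\<ell> A \<otimes> \<ell> B) \<cdot> \<alpha> (\<T>\<^sub>o A) (\<T>\<^sub>o B) \<cdot> \<T>\<^sub>a (\<alpha> A B) = \<alpha> A B \<cdot> \<ell> (A \<Otimes> B)"
    and Tprod_flip: "A \<in> Ob X \<Longrightarrow> B \<in> Ob X \<Longrightarrow>
      (\<c> A \<otimes> \<c> B) \<cdot> \<alpha> (\<T>\<^sub>o A) (\<T>\<^sub>o B) \<cdot> \<T>\<^sub>a (\<alpha> A B) =
      \<alpha> (\<T>\<^sub>o A) (\<T>\<^sub>o B) \<cdot> \<T>\<^sub>a (\<alpha> A B) \<cdot> \<c> (A \<Otimes> B)"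


section \<open>Group objects and the tangent space at the unit\<close>

locale group_object = cartesian_tangent_category X
  for X :: "('o, 'a, 'x) cartesian_tangent_category_scheme" (structure)
    and G :: 'o and m :: 'a and u :: 'a and \<iota> :: 'a +
  assumes carrier: "G \<in> Ob X"
    and mult: "m \<in> hom X (G \<Otimes> G) G"
    and unit: "u \<in> hom X \<I> G"
    and inv: "\<iota> \<in> hom X G G"
    and mult_assoc: "(m \<otimes> \<one> G) \<cdot> m =
      \<langle>pfst X (G \<Otimes> G) G \<cdot> pfst X G G, \<langle>pfst X (G \<Otimes> G) G \<cdot> psnd X G G, psnd X (G \<Otimes> G) G\<rangle>\<rangle> \<cdot>
        (\<one> G \<otimes> m) \<cdot> m"
    and unit_left: "\<langle>! G \<cdot> u, \<one> G\<rangle> \<cdot> m = \<one> G"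
    and unit_right: "\<langle>\<one> G, ! G \<cdot> u\<rangle> \<cdot> m = \<one> G"
    and inv_left: "\<langle>\<iota>, \<one> G\<rangle> \<cdot> m = ! G \<cdot> u"
    and inv_right: "\<langle>\<one> G, \<iota>\<rangle> \<cdot> m = ! G \<cdot> u"

text \<open>
  Below, \<open>Gu\<close> is the pullback \<open>T(G)\<^sub>u\<close> and \<open>pu\<close> the projection \<open>p\<^sub>u\<^sup>* : T(G)\<^sub>u \<rightarrow> T(G)\<close>.
  \<open>ulift\<close> is the operation sending \<open>h\<close> to \<open>\<langle>!, h\<rangle>\<close>.
\<close>

definition ulift ::
  "('o, 'a, 'x) cartesian_tangent_category_scheme \<Rightarrow> 'o \<Rightarrow> 'a \<Rightarrow> 'a \<Rightarrow> 'a" where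
  "ulift X Gu pu h = (THE k. k \<in> hom X (src X h) Gu \<and> comp X k pu = h)"

definition zero_u ::
  "('o, 'a, 'x) cartesian_tangent_category_scheme \<Rightarrow> 'o \<Rightarrow> 'a \<Rightarrow> 'o \<Rightarrow> 'a \<Rightarrow> 'a" where
  "zero_u X G u Gu pu = ulift X Gu pu (comp X u (tzero X G))"

definition add_u ::
  "('o, 'a, 'x) cartesian_tangent_category_scheme \<Rightarrow> 'o \<Rightarrow> 'o \<Rightarrow> 'a \<Rightarrow> 'a" where
  "add_u X G Gu pu =
     ulift X Gu pu
       (comp X (bpair X (tbundle X G) (comp X (pfst X Gu Gu) pu) (comp X (psnd X Gu Gu) pu))
          (tadd X G))"

definition phi_inv ::
  "('o, 'a, 'x) cartesian_tangent_category_scheme \<Rightarrow> 'o \<Rightarrow> 'a \<Rightarrow> 'a \<Rightarrow> 'a" where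
  "phi_inv X G m pu = comp X (comp X (cross X (tzero X G) pu) (Tprod_iso X G G)) (Tar X m)"

text \<open>
  The map \<open>\<langle>\<langle>\<pi>\<^sub>0, \<pi>\<^sub>1\<rangle>\<phi>\<^sup>-\<^sup>1, \<langle>\<pi>\<^sub>0, \<pi>\<^sub>2\<rangle>\<phi>\<^sup>-\<^sup>1\<rangle>\<close> into \<open>T\<^sub>2(G)\<close>; the ternary product is
  \<open>G \<times> (T(G)\<^sub>u \<times> T(G)\<^sub>u)\<close>.
\<close>

definition phi2_inv ::
  "('o, 'a, 'x) cartesian_tangent_category_scheme \<Rightarrow> 'o \<Rightarrow> 'a \<Rightarrow> 'o \<Rightarrow> 'a \<Rightarrow> 'a" where
  "phi2_inv X G m Gu pu =
     (let D = Prod X Gu Gu;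
          p0 = pfst X G D;
          p1 = comp X (psnd X G D) (pfst X Gu Gu);
          p2 = comp X (psnd X G D) (psnd X Gu Gu)
      in bpair X (tbundle X G)
           (comp X (pair X p0 p1) (phi_inv X G m pu)) (comp X (pair X p0 p2) (phi_inv X G m pu)))"

end

theory Submission
  imports Defs
begin

text \<open>
  Read an arrow \<open>Y \<rightarrow> T G\<close> as a generalized tangent vector and let \<open>x \<bullet> y\<close> be
  \<open>\<langle>x, y\<rangle> \<alpha> T(m)\<close>.  Since \<open>T\<close> preserves products, this makes the arrows \<open>Y \<rightarrow> T G\<close> a group,
  just as \<open>m\<close> makes the arrows \<open>Y \<rightarrow> G\<close> a group.  The three natural transformations \<open>p\<close>, \<open>0\<close>
  and \<open>+\<close> are natural with respect to \<open>m\<close> and compatible with products, so each of them is a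
  homomorphism for these multiplications: \<open>Tmul_p\<close>, \<open>Tmul_zero\<close>, \<open>Tmul_add\<close>.

  By \<open>pair_phi_inv\<close>, the map \<open>\<phi>\<^sup>-\<^sup>1\<close> sends \<open>(a, v)\<close> to the left translate \<open>a0 \<bullet> v\<close> of the vector
  \<open>v\<close> at the unit.  It is invertible because left translation by \<open>a0\<close> is undone by translation
  by \<open>a\<^sup>-\<^sup>1 0\<close>: a vector \<open>x\<close> at \<open>a = xp\<close> comes from \<open>a\<close> and from \<open>a\<^sup>-\<^sup>1 0 \<bullet> x\<close>, which lies over
  the unit.  The four squares are then instances of the homomorphism laws:

    \<^item> addition: \<open>a0 \<bullet> v + a0 \<bullet> w = (a0 + a0) \<bullet> (v + w) = a0 \<bullet> (v + w)\<close>;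
    \<^item> zero: \<open>a0 \<bullet> u0 = (au)0 = a0\<close>;
    \<^item> projection: \<open>(a0 \<bullet> v)p = a (vp) = au = a\<close>;
    \<^item> unit: the square for zero at \<open>a = u\<close>, together with naturality of \<open>0\<close> at \<open>u\<close>.

  The remaining vertical arrows, apart from identities, are the map into \<open>T\<^sub>2 G\<close>, which is \<open>\<phi>\<^sup>-\<^sup>1\<close> on each of the two
  vectors, and \<open>0\<^sub>1\<close>.  The latter is invertible because preservation of binary products already
  forces preservation of the terminal object (\<open>T_terminal_ext\<close>).
\<close>


section \<open>Arrow calculus\<close>

lemma pullback_ex1:
  assumes "is_pullback X s t P a b" "f \<in> hom X Y (src X s)" "g \<in> hom X Y (src X t)"
    "comp X f s = comp X g t"
  shows "\<exists>!h. h \<in> hom X Y P \<and> comp X h a = f \<and> comp X h b = g"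
  using assms unfolding is_pullback_def by blast

lemma product_ex1:
  assumes "is_product X A B P a b" "f \<in> hom X Y A" "g \<in> hom X Y B"
  shows "\<exists>!h. h \<in> hom X Y P \<and> comp X h a = f \<and> comp X h b = g"
  using assms unfolding is_product_def by blast

context category
begin

text \<open>
  Typing facts are kept as separate equations for \<open>src\<close> and \<open>tgt\<close> rather than as hom-set
  membership: the simplifier then computes the domain and codomain of any composite, and the
  rules below have no side condition with an object that it would have to guess.
\<close>

lemma comp_Ar [simp]:
  assumes "f \<in> Ar X" "g \<in> Ar X" "tgt X f = src X g"
  shows "f \<cdot> g \<in> Ar X" "src X (f \<cdot> g) = src X f" "tgt X (f \<cdot> g) = tgt X g"
  using comp_hom[of f "src X f" "tgt X f" g "tgt X g"] assms by (auto simp: hom_def)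

lemma ident_Ar [simp]:
  assumes "A \<in> Ob X"
  shows "\<one> A \<in> Ar X" "src X (\<one> A) = A" "tgt X (\<one> A) = A"
  using ident_hom[OF assms] by (auto simp: hom_def)

declare src_ob [simp] tgt_ob [simp]

lemma comp_assoc' [simp]:
  assumes "f \<in> Ar X" "g \<in> Ar X" "h \<in> Ar X" "tgt X f = src X g" "tgt X g = src X h"
  shows "f \<cdot> g \<cdot> h = f \<cdot> (g \<cdot> h)"
  using comp_assoc[of f "src X f" "tgt X f" g "tgt X g" h "tgt X h"] assms
  by (auto simp: hom_def)

lemma ident_left [simp]: "f \<in> Ar X \<Longrightarrow> src X f = A \<Longrightarrow> \<one> A \<cdot> f = f"
  using ident_comp[of f A "tgt X f"] by (auto simp: hom_def)

lemma ident_right [simp]: "f \<in> Ar X \<Longrightarrow> tgt X f = B \<Longrightarrow> f \<cdot> \<one> B = f"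
  using comp_ident[of f "src X f" B] by (auto simp: hom_def)

lemma is_isoI:
  assumes "f \<in> hom X A B" "g \<in> hom X B A" "f \<cdot> g = \<one> A" "g \<cdot> f = \<one> B"
  shows "is_iso X f"
  using assms unfolding is_iso_def inverse_arrows_def by (auto simp: hom_def)

lemma inverse_of_props:
  assumes "is_iso X f"
  shows "inverse_arrows X f (inverse_of X f)"
proof -
  obtain g where g: "inverse_arrows X f g"
    using assms by (auto simp: is_iso_def)
  have "h = g" if h: "inverse_arrows X f h" for h
  proof -
    have [simp]: "f \<in> Ar X" "h \<in> Ar X" "g \<in> Ar X" "src X h = tgt X f" "tgt X h = src X f"
      "src X g = tgt X f" "tgt X g = src X f"
      using g h by (auto simp: inverse_arrows_def hom_def)
    have "h = h \<cdot> (f \<cdot> g)" using g by (simp add: inverse_arrows_def)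
    also have "\<dots> = (h \<cdot> f) \<cdot> g" by simp
    also have "\<dots> = g" using h by (simp add: inverse_arrows_def del: comp_assoc')
    finally show ?thesis .
  qed
  with g show ?thesis unfolding inverse_of_def by (blast intro: theI2)
qed

lemma pullback_ext:
  assumes pb: "is_pullback X s t P a b" and h: "h \<in> hom X Y P" and k: "k \<in> hom X Y P"
    and a: "h \<cdot> a = k \<cdot> a" and b: "h \<cdot> b = k \<cdot> b"
  shows "h = k"
proof -
  have typing: "a \<in> hom X P (src X s)" "b \<in> hom X P (src X t)" "a \<cdot> s = b \<cdot> t"
    "s \<in> hom X (src X s) (tgt X s)" "t \<in> hom X (src X t) (tgt X t)"
    using pb by (simp_all add: is_pullback_def hom_def)
  have "k \<cdot> a \<in> hom X Y (src X s)" "k \<cdot> b \<in> hom X Y (src X t)"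
    using k typing by (blast intro: comp_hom)+
  moreover have "k \<cdot> a \<cdot> s = k \<cdot> b \<cdot> t"
    by (simp only: comp_assoc[OF k typing(1,4)] comp_assoc[OF k typing(2,5)] typing(3))
  ultimately have "\<exists>!l. l \<in> hom X Y P \<and> l \<cdot> a = k \<cdot> a \<and> l \<cdot> b = k \<cdot> b"
    by (rule pullback_ex1[OF pb])
  with h k a b show ?thesis by blast
qed

lemma product_ext:
  assumes pr: "is_product X A B P a b" and h: "h \<in> hom X Y P" and k: "k \<in> hom X Y P"
    and a: "h \<cdot> a = k \<cdot> a" and b: "h \<cdot> b = k \<cdot> b"
  shows "h = k"
proof -
  have "a \<in> hom X P A" "b \<in> hom X P B" using pr by (simp_all add: is_product_def)
  then have "k \<cdot> a \<in> hom X Y A" "k \<cdot> b \<in> hom X Y B"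
    using k by (blast intro: comp_hom)+
  then have "\<exists>!l. l \<in> hom X Y P \<and> l \<cdot> a = k \<cdot> a \<and> l \<cdot> b = k \<cdot> b"
    by (rule product_ex1[OF pr])
  with h k a b show ?thesis by blast
qed

end

lemma span_pair_props:
  assumes "\<exists>!h. h \<in> hom X (src X f) P \<and> comp X h a = f \<and> comp X h b = g"
  shows "span_pair X P a b f g \<in> hom X (src X f) P"
    "comp X (span_pair X P a b f g) a = f" "comp X (span_pair X P a b f g) b = g"
  using theI'[OF assms] by (auto simp: span_pair_def)


section \<open>Generalized tangent vectors and their sums\<close>

text \<open>
  Meaningful only if \<open>x p = y p\<close>: otherwise the pairing into \<open>T\<^sub>2 M\<close> is unspecified.
\<close>

definition tplus :: "('o, 'a, 'x) tangent_category_scheme \<Rightarrow> 'o \<Rightarrow> 'a \<Rightarrow> 'a \<Rightarrow> 'a" where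
  "tplus X M x y = comp X (bpair X (tbundle X M) x y) (tadd X M)"

context tangent_category
begin

lemma T_Ob [simp]: "A \<in> Ob X \<Longrightarrow> \<T>\<^sub>o A \<in> Ob X"
  using T_functor by (auto simp: endofunctor_def)

lemma T_Ar [simp]:
  assumes "f \<in> Ar X"
  shows "\<T>\<^sub>a f \<in> Ar X" "src X (\<T>\<^sub>a f) = \<T>\<^sub>o (src X f)" "tgt X (\<T>\<^sub>a f) = \<T>\<^sub>o (tgt X f)"
proof -
  have "\<T>\<^sub>a f \<in> hom X (\<T>\<^sub>o (src X f)) (\<T>\<^sub>o (tgt X f))"
    using T_functor assms by (auto simp: endofunctor_def hom_def)
  then show "\<T>\<^sub>a f \<in> Ar X" "src X (\<T>\<^sub>a f) = \<T>\<^sub>o (src X f)" "tgt X (\<T>\<^sub>a f) = \<T>\<^sub>o (tgt X f)"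
    by (auto simp: hom_def)
qed

lemma T_ident [simp]: "A \<in> Ob X \<Longrightarrow> \<T>\<^sub>a (\<one> A) = \<one> (\<T>\<^sub>o A)"
  using T_functor by (auto simp: endofunctor_def)

lemma T_comp [simp]:
  "f \<in> Ar X \<Longrightarrow> g \<in> Ar X \<Longrightarrow> tgt X f = src X g \<Longrightarrow> \<T>\<^sub>a (f \<cdot> g) = \<T>\<^sub>a f \<cdot> \<T>\<^sub>a g"
  using T_functor by (auto simp: endofunctor_def hom_def)

lemma p_Ar [simp]:
  assumes "A \<in> Ob X"
  shows "\<p> A \<in> Ar X" "src X (\<p> A) = \<T>\<^sub>o A" "tgt X (\<p> A) = A"
  using p_nat assms by (auto simp: nat_trans_def hom_def)

lemma zero_Ar [simp]:
  assumes "A \<in> Ob X"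
  shows "\<zero> A \<in> Ar X" "src X (\<zero> A) = A" "tgt X (\<zero> A) = \<T>\<^sub>o A"
  using zero_nat assms by (auto simp: nat_trans_def hom_def)

lemma add_Ar [simp]:
  assumes "A \<in> Ob X"
  shows "\<oplus> A \<in> Ar X" "src X (\<oplus> A) = \<T>\<^sub>2 A" "tgt X (\<oplus> A) = \<T>\<^sub>o A"
  using add_nat assms by (auto simp: nat_trans_def hom_def)

lemma p_natural: "f \<in> Ar X \<Longrightarrow> tgt X f = B \<Longrightarrow> \<T>\<^sub>a f \<cdot> \<p> B = \<p> (src X f) \<cdot> f"
  using p_nat by (auto simp: nat_trans_def hom_def)

lemma zero_natural: "f \<in> Ar X \<Longrightarrow> src X f = A \<Longrightarrow> \<zero> A \<cdot> \<T>\<^sub>a f = f \<cdot> \<zero> (tgt X f)"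
  using zero_nat by (auto simp: nat_trans_def hom_def)

lemma add_natural: "f \<in> Ar X \<Longrightarrow> src X f = A \<Longrightarrow> \<oplus> A \<cdot> \<T>\<^sub>a f = Tsq_ar X f \<cdot> \<oplus> (tgt X f)"
  using add_nat by (auto simp: nat_trans_def hom_def)

lemma zero_p [simp]: "A \<in> Ob X \<Longrightarrow> \<zero> A \<cdot> \<p> A = \<one> A"
  using additive[of A] by (simp add: additive_bundle_def tbundle_def Let_def)

lemma Tsq_proj [simp]:
  assumes "A \<in> Ob X"
  shows "\<pi>\<^sub>0 A \<in> Ar X" "src X (\<pi>\<^sub>0 A) = \<T>\<^sub>2 A" "tgt X (\<pi>\<^sub>0 A) = \<T>\<^sub>o A"
    "\<pi>\<^sub>1 A \<in> Ar X" "src X (\<pi>\<^sub>1 A) = \<T>\<^sub>2 A" "tgt X (\<pi>\<^sub>1 A) = \<T>\<^sub>o A"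
    "\<T>\<^sub>2 A \<in> Ob X" "\<pi>\<^sub>1 A \<cdot> \<p> A = \<pi>\<^sub>0 A \<cdot> \<p> A"
  using Tsq_pullback[OF assms] assms src_ob[of "\<pi>\<^sub>0 A"] by (auto simp: is_pullback_def hom_def)

lemma bpair_props:
  assumes "x \<in> Ar X" "y \<in> Ar X" "src X x = src X y" "tgt X x = \<T>\<^sub>o M" "tgt X y = \<T>\<^sub>o M"
    "x \<cdot> \<p> M = y \<cdot> \<p> M" "M \<in> Ob X"
  shows bpair_Ar: "bpair X (tbundle X M) x y \<in> Ar X" "src X (bpair X (tbundle X M) x y) = src X x"
      "tgt X (bpair X (tbundle X M) x y) = \<T>\<^sub>2 M"
    and bpair_fst: "bpair X (tbundle X M) x y \<cdot> \<pi>\<^sub>0 M = x"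
    and bpair_snd: "bpair X (tbundle X M) x y \<cdot> \<pi>\<^sub>1 M = y"
proof -
  have "\<exists>!h. h \<in> hom X (src X x) (\<T>\<^sub>2 M) \<and> h \<cdot> \<pi>\<^sub>0 M = x \<and> h \<cdot> \<pi>\<^sub>1 M = y"
    by (rule pullback_ex1[OF Tsq_pullback[OF assms(7)]]) (use assms in \<open>simp_all add: hom_def\<close>)
  from span_pair_props[OF this]
  show "bpair X (tbundle X M) x y \<in> Ar X" "src X (bpair X (tbundle X M) x y) = src X x"
      "tgt X (bpair X (tbundle X M) x y) = \<T>\<^sub>2 M"
    "bpair X (tbundle X M) x y \<cdot> \<pi>\<^sub>0 M = x" "bpair X (tbundle X M) x y \<cdot> \<pi>\<^sub>1 M = y"
    by (auto simp: bpair_def tbundle_def hom_def)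
qed

lemma Tsq_ext:
  assumes "h \<in> Ar X" "k \<in> Ar X" "src X h = src X k" "tgt X h = \<T>\<^sub>2 M" "tgt X k = \<T>\<^sub>2 M"
    "h \<cdot> \<pi>\<^sub>0 M = k \<cdot> \<pi>\<^sub>0 M" "h \<cdot> \<pi>\<^sub>1 M = k \<cdot> \<pi>\<^sub>1 M" "M \<in> Ob X"
  shows "h = k"
proof (rule pullback_ext[OF Tsq_pullback[OF assms(8)] _ _ assms(6,7)])
  show "h \<in> hom X (src X h) (\<T>\<^sub>2 M)" "k \<in> hom X (src X h) (\<T>\<^sub>2 M)"
    using assms(1-5) by (simp_all add: hom_def)
qed

lemma comp_bpair:
  assumes "h \<in> Ar X" "tgt X h = src X x"
    "x \<in> Ar X" "y \<in> Ar X" "src X x = src X y" "tgt X x = \<T>\<^sub>o M" "tgt X y = \<T>\<^sub>o M"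
    "x \<cdot> \<p> M = y \<cdot> \<p> M" "M \<in> Ob X"
  shows "h \<cdot> bpair X (tbundle X M) x y = bpair X (tbundle X M) (h \<cdot> x) (h \<cdot> y)"
proof (rule Tsq_ext[of _ _ M])
  note [simp] = assms bpair_props[OF assms(3-9)]
  have e: "(h \<cdot> x) \<cdot> \<p> M = (h \<cdot> y) \<cdot> \<p> M" by simp
  have e': "h \<cdot> x \<in> Ar X" "h \<cdot> y \<in> Ar X" "src X (h \<cdot> x) = src X (h \<cdot> y)"
    "tgt X (h \<cdot> x) = \<T>\<^sub>o M" "tgt X (h \<cdot> y) = \<T>\<^sub>o M"
    by (simp_all only: comp_Ar assms)
  note [simp] = bpair_props[OF e' e assms(9)]
  show "h \<cdot> bpair X (tbundle X M) x y \<in> Ar X" "bpair X (tbundle X M) (h \<cdot> x) (h \<cdot> y) \<in> Ar X"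
    "src X (h \<cdot> bpair X (tbundle X M) x y) = src X (bpair X (tbundle X M) (h \<cdot> x) (h \<cdot> y))"
    "tgt X (h \<cdot> bpair X (tbundle X M) x y) = \<T>\<^sub>2 M"
    "tgt X (bpair X (tbundle X M) (h \<cdot> x) (h \<cdot> y)) = \<T>\<^sub>2 M"
    "h \<cdot> bpair X (tbundle X M) x y \<cdot> \<pi>\<^sub>0 M = bpair X (tbundle X M) (h \<cdot> x) (h \<cdot> y) \<cdot> \<pi>\<^sub>0 M"
    "h \<cdot> bpair X (tbundle X M) x y \<cdot> \<pi>\<^sub>1 M = bpair X (tbundle X M) (h \<cdot> x) (h \<cdot> y) \<cdot> \<pi>\<^sub>1 M"
    "M \<in> Ob X"
    by simp_all
qed

lemma comp_tplus:
  assumes "h \<in> Ar X" "tgt X h = src X x"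
    "x \<in> Ar X" "y \<in> Ar X" "src X x = src X y" "tgt X x = \<T>\<^sub>o M" "tgt X y = \<T>\<^sub>o M"
    "x \<cdot> \<p> M = y \<cdot> \<p> M" "M \<in> Ob X"
  shows "h \<cdot> tplus X M x y = tplus X M (h \<cdot> x) (h \<cdot> y)"
  unfolding tplus_def comp_bpair[OF assms, symmetric]
  using assms bpair_props[OF assms(3-9)] by simp

lemma tplus_props:
  assumes "x \<in> Ar X" "y \<in> Ar X" "src X x = src X y" "tgt X x = \<T>\<^sub>o M" "tgt X y = \<T>\<^sub>o M"
    "x \<cdot> \<p> M = y \<cdot> \<p> M" "M \<in> Ob X"
  shows tplus_Ar: "tplus X M x y \<in> Ar X" "src X (tplus X M x y) = src X x"
      "tgt X (tplus X M x y) = \<T>\<^sub>o M"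
    and tplus_p: "tplus X M x y \<cdot> \<p> M = x \<cdot> \<p> M"
proof -
  note [simp] = assms bpair_props[OF assms]
  show "tplus X M x y \<in> Ar X" "src X (tplus X M x y) = src X x" "tgt X (tplus X M x y) = \<T>\<^sub>o M"
    by (simp_all add: tplus_def)
  have "\<oplus> M \<cdot> \<p> M = \<pi>\<^sub>0 M \<cdot> \<p> M"
    using additive[of M] by (simp add: additive_bundle_def tbundle_def Let_def)
  then have "tplus X M x y \<cdot> \<p> M = (bpair X (tbundle X M) x y \<cdot> \<pi>\<^sub>0 M) \<cdot> \<p> M"
    by (simp add: tplus_def del: bpair_fst[OF assms])
  then show "tplus X M x y \<cdot> \<p> M = x \<cdot> \<p> M"
    by (simp del: comp_assoc')
qed

text \<open>
  Precomposing the left unit law of the bundle \<open>p\<close> with \<open>a 0\<close> replaces its zero summand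
  \<open>p 0\<close> by \<open>a 0 p 0 = a 0\<close>.
\<close>

lemma tplus_zero:
  assumes "a \<in> Ar X" "tgt X a = M"
  shows "tplus X M (a \<cdot> \<zero> M) (a \<cdot> \<zero> M) = a \<cdot> \<zero> M"
proof -
  have [simp]: "M \<in> Ob X" using assms by auto
  note [simp] = assms
  have unit: "tplus X M (\<p> M \<cdot> \<zero> M) (\<one> (\<T>\<^sub>o M)) = \<one> (\<T>\<^sub>o M)"
    using additive[of M] by (simp add: additive_bundle_def tbundle_def Let_def tplus_def)
  have zp: "\<zero> M \<cdot> (\<p> M \<cdot> \<zero> M) = \<zero> M"
    using comp_assoc'[of "\<zero> M" "\<p> M" "\<zero> M"] by simp
  have "a \<cdot> \<zero> M = (a \<cdot> \<zero> M) \<cdot> tplus X M (\<p> M \<cdot> \<zero> M) (\<one> (\<T>\<^sub>o M))"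
    by (simp only: unit) simp
  also have "\<dots> = tplus X M ((a \<cdot> \<zero> M) \<cdot> (\<p> M \<cdot> \<zero> M)) ((a \<cdot> \<zero> M) \<cdot> \<one> (\<T>\<^sub>o M))"
    by (rule comp_tplus) simp_all
  finally show ?thesis by (simp add: zp)
qed

text \<open>
  Naturality of addition, in terms of generalized elements: a tangent map is fibrewise additive.
\<close>

lemma tplus_T:
  assumes "x \<in> Ar X" "y \<in> Ar X" "src X x = src X y" "tgt X x = \<T>\<^sub>o M" "tgt X y = \<T>\<^sub>o M"
    "x \<cdot> \<p> M = y \<cdot> \<p> M" "f \<in> Ar X" "src X f = M" "tgt X f = N"
  shows "tplus X M x y \<cdot> \<T>\<^sub>a f = tplus X N (x \<cdot> \<T>\<^sub>a f) (y \<cdot> \<T>\<^sub>a f)"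
proof -
  have M [simp]: "M \<in> Ob X" and [simp]: "N \<in> Ob X" using assms by auto
  note [simp] = assms bpair_props[OF assms(1-6) M]
  let ?b = "bpair X (tbundle X M) x y"
  have e: "(\<pi>\<^sub>0 M \<cdot> \<T>\<^sub>a f) \<cdot> \<p> N = (\<pi>\<^sub>1 M \<cdot> \<T>\<^sub>a f) \<cdot> \<p> N"
    using comp_assoc'[of "\<pi>\<^sub>1 M" "\<p> M" f]  comp_assoc'[of "\<pi>\<^sub>0 M" "\<p> M" f]
    by (simp add: p_natural)
  have Ar: "Tsq_ar X f \<in> Ar X" "src X (Tsq_ar X f) = \<T>\<^sub>2 M" "tgt X (Tsq_ar X f) = \<T>\<^sub>2 N"
    using bpair_Ar[OF _ _ _ _ _ e] by (simp_all add: Tsq_ar_def)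
  have "tplus X M x y \<cdot> \<T>\<^sub>a f = ?b \<cdot> (\<oplus> M \<cdot> \<T>\<^sub>a f)"
    by (simp add: tplus_def)
  also have "\<oplus> M \<cdot> \<T>\<^sub>a f = Tsq_ar X f \<cdot> \<oplus> N"
    by (simp add: add_natural)
  also have "?b \<cdot> (Tsq_ar X f \<cdot> \<oplus> N) = (?b \<cdot> Tsq_ar X f) \<cdot> \<oplus> N"
    using Ar by simp
  also have "?b \<cdot> Tsq_ar X f
      = bpair X (tbundle X N) (?b \<cdot> (\<pi>\<^sub>0 M \<cdot> \<T>\<^sub>a f)) (?b \<cdot> (\<pi>\<^sub>1 M \<cdot> \<T>\<^sub>a f))"
    unfolding Tsq_ar_def using e by (simp add: comp_bpair)
  also have "?b \<cdot> (\<pi>\<^sub>0 M \<cdot> \<T>\<^sub>a f) = x \<cdot> \<T>\<^sub>a f"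
    using comp_assoc'[of ?b "\<pi>\<^sub>0 M" "\<T>\<^sub>a f"] by simp
  also have "?b \<cdot> (\<pi>\<^sub>1 M \<cdot> \<T>\<^sub>a f) = y \<cdot> \<T>\<^sub>a f"
    using comp_assoc'[of ?b "\<pi>\<^sub>1 M" "\<T>\<^sub>a f"] by simp
  finally show ?thesis by (simp add: tplus_def)
qed

end

section \<open>Products and their image under the tangent functor\<close>

context cartesian_tangent_category
begin

lemma terminal_Ob [simp]: "\<I> \<in> Ob X"
  using terminal by (auto simp: is_terminal_def)

lemma bang_Ar [simp]:
  assumes "A \<in> Ob X"
  shows "! A \<in> Ar X" "src X (! A) = A" "tgt X (! A) = \<I>"
proof -
  have "\<exists>!h. h \<in> hom X A \<I>" using terminal assms by (auto simp: is_terminal_def)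
  from theI'[OF this] show "! A \<in> Ar X" "src X (! A) = A" "tgt X (! A) = \<I>"
    by (auto simp: bang_def hom_def)
qed

lemma terminal_ext:
  assumes "f \<in> Ar X" "g \<in> Ar X" "src X f = src X g" "tgt X f = \<I>" "tgt X g = \<I>"
  shows "f = g"
proof -
  have "\<exists>!h. h \<in> hom X (src X g) \<I>" using terminal assms by (auto simp: is_terminal_def)
  then show ?thesis using assms by (auto simp: hom_def)
qed

lemma comp_bang [simp]:
  assumes "f \<in> Ar X" "tgt X f = A"
  shows "f \<cdot> ! A = ! (src X f)"
  using assms by - (rule terminal_ext, auto)

lemma bang_terminal [simp]: "! \<I> = \<one> \<I>"
  by (rule terminal_ext) simp_all

lemma proj_Ar [simp]:
  assumes "A \<in> Ob X" "B \<in> Ob X"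
  shows "pfst X A B \<in> Ar X" "src X (pfst X A B) = A \<Otimes> B" "tgt X (pfst X A B) = A"
    "psnd X A B \<in> Ar X" "src X (psnd X A B) = A \<Otimes> B" "tgt X (psnd X A B) = B"
    "A \<Otimes> B \<in> Ob X"
  using product[OF assms] src_ob[of "pfst X A B"] by (auto simp: is_product_def hom_def)

lemma pair_props [simp]:
  assumes "f \<in> Ar X" "g \<in> Ar X" "src X f = src X g"
  shows "\<langle>f, g\<rangle> \<in> Ar X" "src X \<langle>f, g\<rangle> = src X f" "tgt X \<langle>f, g\<rangle> = tgt X f \<Otimes> tgt X g"
    "tgt X f = A \<Longrightarrow> tgt X g = B \<Longrightarrow> \<langle>f, g\<rangle> \<cdot> pfst X A B = f"
    "tgt X f = A \<Longrightarrow> tgt X g = B \<Longrightarrow> \<langle>f, g\<rangle> \<cdot> psnd X A B = g"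
proof -
  have "\<exists>!h. h \<in> hom X (src X f) (tgt X f \<Otimes> tgt X g) \<and> h \<cdot> pfst X (tgt X f) (tgt X g) = f \<and>
      h \<cdot> psnd X (tgt X f) (tgt X g) = g"
    by (rule product_ex1[OF product]) (use assms in \<open>simp_all add: hom_def\<close>)
  from span_pair_props[OF this]
  show "\<langle>f, g\<rangle> \<in> Ar X" "src X \<langle>f, g\<rangle> = src X f" "tgt X \<langle>f, g\<rangle> = tgt X f \<Otimes> tgt X g"
    "tgt X f = A \<Longrightarrow> tgt X g = B \<Longrightarrow> \<langle>f, g\<rangle> \<cdot> pfst X A B = f"
    "tgt X f = A \<Longrightarrow> tgt X g = B \<Longrightarrow> \<langle>f, g\<rangle> \<cdot> psnd X A B = g"
    by (auto simp: pair_def hom_def)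
qed

lemma pair_proj_comp [simp]:
  assumes "f \<in> Ar X" "g \<in> Ar X" "src X f = src X g" "tgt X f = A" "tgt X g = B" "h \<in> Ar X"
  shows "src X h = A \<Longrightarrow> \<langle>f, g\<rangle> \<cdot> (pfst X A B \<cdot> h) = f \<cdot> h"
    "src X h = B \<Longrightarrow> \<langle>f, g\<rangle> \<cdot> (psnd X A B \<cdot> h) = g \<cdot> h"
proof -
  have [simp]: "A \<in> Ob X" "B \<in> Ob X" using assms by auto
  show "src X h = A \<Longrightarrow> \<langle>f, g\<rangle> \<cdot> (pfst X A B \<cdot> h) = f \<cdot> h"
    using assms comp_assoc'[of "\<langle>f, g\<rangle>" "pfst X A B" h] by simp
  show "src X h = B \<Longrightarrow> \<langle>f, g\<rangle> \<cdot> (psnd X A B \<cdot> h) = g \<cdot> h"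
    using assms comp_assoc'[of "\<langle>f, g\<rangle>" "psnd X A B" h] by simp
qed

lemma prod_ext:
  assumes "h \<in> Ar X" "k \<in> Ar X" "src X h = src X k" "tgt X h = A \<Otimes> B" "tgt X k = A \<Otimes> B"
    "h \<cdot> pfst X A B = k \<cdot> pfst X A B" "h \<cdot> psnd X A B = k \<cdot> psnd X A B" "A \<in> Ob X" "B \<in> Ob X"
  shows "h = k"
proof (rule product_ext[OF product[OF assms(8,9)] _ _ assms(6,7)])
  show "h \<in> hom X (src X h) (A \<Otimes> B)" "k \<in> hom X (src X h) (A \<Otimes> B)"
    using assms(1-5) by (simp_all add: hom_def)
qed

lemma comp_pair [simp]:
  assumes "h \<in> Ar X" "f \<in> Ar X" "g \<in> Ar X" "src X f = src X g" "tgt X h = src X f"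
  shows "h \<cdot> \<langle>f, g\<rangle> = \<langle>h \<cdot> f, h \<cdot> g\<rangle>"
  by (rule prod_ext[where A = "tgt X f" and B = "tgt X g"]) (use assms in simp_all)

lemma pair_comp_cross:
  assumes "x \<in> Ar X" "y \<in> Ar X" "src X x = src X y"
    "f \<in> Ar X" "g \<in> Ar X" "tgt X x = src X f" "tgt X y = src X g"
  shows "\<langle>x, y\<rangle> \<cdot> (f \<otimes> g) = \<langle>x \<cdot> f, y \<cdot> g\<rangle>"
  using assms by (simp add: cross_def)

lemma cross_Ar [simp]:
  assumes "f \<in> Ar X" "g \<in> Ar X"
  shows "f \<otimes> g \<in> Ar X" "src X (f \<otimes> g) = src X f \<Otimes> src X g" "tgt X (f \<otimes> g) = tgt X f \<Otimes> tgt X g"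
  using assms by (simp_all add: cross_def)

lemma Tprod_iso_inverse:
  assumes "A \<in> Ob X" "B \<in> Ob X"
  shows "inverse_arrows X \<langle>\<T>\<^sub>a (pfst X A B), \<T>\<^sub>a (psnd X A B)\<rangle> (\<alpha> A B)"
  unfolding Tprod_iso_def using assms by (intro inverse_of_props comparison_iso)

lemma alpha_Ar [simp]:
  assumes "A \<in> Ob X" "B \<in> Ob X"
  shows "\<alpha> A B \<in> Ar X" "src X (\<alpha> A B) = \<T>\<^sub>o A \<Otimes> \<T>\<^sub>o B" "tgt X (\<alpha> A B) = \<T>\<^sub>o (A \<Otimes> B)"
  using Tprod_iso_inverse[OF assms] assms by (auto simp: inverse_arrows_def hom_def)

text \<open>
  The map \<open>\<alpha>\<close> is an inverse of the comparison map, and this lemma and \<open>alpha_proj\<close> are its two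
  inverse laws on generalized elements: \<open>T(A \<times> B)\<close> is a product of \<open>T A\<close> and \<open>T B\<close>, with
  projections \<open>T(\<pi>\<^sub>0)\<close> and \<open>T(\<pi>\<^sub>1)\<close> and pairing \<open>\<langle>x, y\<rangle> \<alpha>\<close>.
\<close>

lemma T_pair:
  assumes "w \<in> Ar X" "f \<in> Ar X" "g \<in> Ar X" "src X f = src X g" "tgt X w = \<T>\<^sub>o (src X f)"
    "tgt X f = A" "tgt X g = B"
  shows "\<langle>w \<cdot> \<T>\<^sub>a f, w \<cdot> \<T>\<^sub>a g\<rangle> \<cdot> \<alpha> A B = w \<cdot> \<T>\<^sub>a \<langle>f, g\<rangle>"
proof -
  have [simp]: "A \<in> Ob X" "B \<in> Ob X" using assms by auto
  note [simp] = assms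
  let ?\<kappa> = "\<langle>\<T>\<^sub>a (pfst X A B), \<T>\<^sub>a (psnd X A B)\<rangle>"
  have inv: "?\<kappa> \<cdot> \<alpha> A B = \<one> (\<T>\<^sub>o (A \<Otimes> B))"
    using Tprod_iso_inverse[of A B] by (simp add: inverse_arrows_def)
  have "\<langle>w \<cdot> \<T>\<^sub>a f, w \<cdot> \<T>\<^sub>a g\<rangle> = w \<cdot> \<T>\<^sub>a \<langle>f, g\<rangle> \<cdot> ?\<kappa>"
    by (simp flip: T_comp)
  then have "\<langle>w \<cdot> \<T>\<^sub>a f, w \<cdot> \<T>\<^sub>a g\<rangle> \<cdot> \<alpha> A B = w \<cdot> \<T>\<^sub>a \<langle>f, g\<rangle> \<cdot> (?\<kappa> \<cdot> \<alpha> A B)"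
    by (simp del: comp_pair)
  then show ?thesis by (simp add: inv)
qed

lemma alpha_proj:
  assumes "x \<in> Ar X" "y \<in> Ar X" "src X x = src X y" "tgt X x = \<T>\<^sub>o A" "tgt X y = \<T>\<^sub>o B"
    "A \<in> Ob X" "B \<in> Ob X"
  shows "\<langle>x, y\<rangle> \<cdot> \<alpha> A B \<cdot> \<T>\<^sub>a (pfst X A B) = x" "\<langle>x, y\<rangle> \<cdot> \<alpha> A B \<cdot> \<T>\<^sub>a (psnd X A B) = y"
proof -
  note [simp] = assms
  let ?\<kappa> = "\<langle>\<T>\<^sub>a (pfst X A B), \<T>\<^sub>a (psnd X A B)\<rangle>"
  have inv: "\<alpha> A B \<cdot> ?\<kappa> = \<one> (\<T>\<^sub>o A \<Otimes> \<T>\<^sub>o B)"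
    using Tprod_iso_inverse[of A B] by (simp add: inverse_arrows_def)
  have f: "?\<kappa> \<cdot> pfst X (\<T>\<^sub>o A) (\<T>\<^sub>o B) = \<T>\<^sub>a (pfst X A B)"
    and s: "?\<kappa> \<cdot> psnd X (\<T>\<^sub>o A) (\<T>\<^sub>o B) = \<T>\<^sub>a (psnd X A B)" by simp_all
  have "\<langle>x, y\<rangle> \<cdot> \<alpha> A B \<cdot> \<T>\<^sub>a (pfst X A B) = \<langle>x, y\<rangle> \<cdot> ((\<alpha> A B \<cdot> ?\<kappa>) \<cdot> pfst X (\<T>\<^sub>o A) (\<T>\<^sub>o B))"
    by (simp del: comp_pair)
  then show "\<langle>x, y\<rangle> \<cdot> \<alpha> A B \<cdot> \<T>\<^sub>a (pfst X A B) = x" by (simp only: inv) simp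
  have "\<langle>x, y\<rangle> \<cdot> \<alpha> A B \<cdot> \<T>\<^sub>a (psnd X A B) = \<langle>x, y\<rangle> \<cdot> ((\<alpha> A B \<cdot> ?\<kappa>) \<cdot> psnd X (\<T>\<^sub>o A) (\<T>\<^sub>o B))"
    by (simp del: comp_pair)
  then show "\<langle>x, y\<rangle> \<cdot> \<alpha> A B \<cdot> \<T>\<^sub>a (psnd X A B) = y" by (simp only: inv) simp
qed

text \<open>
  The two projections \<open>1 \<times> 1 \<rightarrow> 1\<close> are equal, hence so are their images under \<open>T\<close>; these are the
  projections of a product \<open>T 1 \<times> T 1\<close>, so the two components of any pair into it agree.
\<close>

lemma T_terminal_ext:
  assumes "x \<in> Ar X" "y \<in> Ar X" "src X x = src X y" "tgt X x = \<T>\<^sub>o \<I>" "tgt X y = \<T>\<^sub>o \<I>"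
  shows "x = y"
proof -
  have "pfst X \<I> \<I> = psnd X \<I> \<I>" by (rule terminal_ext) simp_all
  then show ?thesis using alpha_proj[of x y \<I> \<I>] assms by simp
qed

lemma zero_terminal_iso: "is_iso X (\<zero> \<I>)"
proof (rule is_isoI)
  show "\<p> \<I> \<cdot> \<zero> \<I> = \<one> (\<T>\<^sub>o \<I>)" by (rule T_terminal_ext) simp_all
qed (simp_all add: hom_def)

text \<open>
  The constant arrow at \<open>u\<close> takes every tangent vector to the zero vector at \<open>u\<close>, as it factors
  through \<open>T 1\<close>.
\<close>

lemma T_bang:
  assumes "x \<in> Ar X" "tgt X x = \<T>\<^sub>o A" "A \<in> Ob X" "u \<in> Ar X" "src X u = \<I>" "tgt X u = B"
  shows "x \<cdot> \<T>\<^sub>a (! A \<cdot> u) = ! (src X x) \<cdot> u \<cdot> \<zero> B"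
proof -
  note [simp] = assms
  have [simp]: "B \<in> Ob X" using tgt_ob[of u] by simp
  have e: "x \<cdot> \<T>\<^sub>a (! A) = ! (src X x) \<cdot> \<zero> \<I>" by (rule T_terminal_ext) simp_all
  have "x \<cdot> \<T>\<^sub>a (! A \<cdot> u) = (x \<cdot> \<T>\<^sub>a (! A)) \<cdot> \<T>\<^sub>a u" by simp
  also have "\<dots> = ! (src X x) \<cdot> (\<zero> \<I> \<cdot> \<T>\<^sub>a u)" unfolding e by simp
  also have "\<dots> = ! (src X x) \<cdot> u \<cdot> \<zero> B" by (simp add: zero_natural)
  finally show ?thesis .
qed

lemma alpha_p:
  assumes "x \<in> Ar X" "y \<in> Ar X" "src X x = src X y" "tgt X x = \<T>\<^sub>o A" "tgt X y = \<T>\<^sub>o B"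
    "A \<in> Ob X" "B \<in> Ob X"
  shows "\<langle>x, y\<rangle> \<cdot> \<alpha> A B \<cdot> \<p> (A \<Otimes> B) = \<langle>x \<cdot> \<p> A, y \<cdot> \<p> B\<rangle>"
  using assms by (simp add: Tprod_proj pair_comp_cross)

lemma alpha_zero:
  assumes "a \<in> Ar X" "b \<in> Ar X" "src X a = src X b" "tgt X a = A" "tgt X b = B"
  shows "\<langle>a \<cdot> \<zero> A, b \<cdot> \<zero> B\<rangle> \<cdot> \<alpha> A B = \<langle>a, b\<rangle> \<cdot> \<zero> (A \<Otimes> B)"
proof -
  have [simp]: "A \<in> Ob X" "B \<in> Ob X" using assms by auto
  note [simp] = assms
  have "\<langle>a, b\<rangle> \<cdot> \<zero> (A \<Otimes> B) = \<langle>a, b\<rangle> \<cdot> (\<zero> A \<otimes> \<zero> B) \<cdot> \<alpha> A B"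
    by (simp flip: Tprod_zero)
  also have "\<langle>a, b\<rangle> \<cdot> (\<zero> A \<otimes> \<zero> B) = \<langle>a \<cdot> \<zero> A, b \<cdot> \<zero> B\<rangle>" by (simp add: pair_comp_cross)
  finally show ?thesis by simp
qed

lemma alpha_add:
  assumes "x \<in> Ar X" "x' \<in> Ar X" "y \<in> Ar X" "y' \<in> Ar X"
    "src X x' = src X x" "src X y = src X x" "src X y' = src X x"
    "tgt X x = \<T>\<^sub>o A" "tgt X x' = \<T>\<^sub>o A" "tgt X y = \<T>\<^sub>o B" "tgt X y' = \<T>\<^sub>o B"
    "x \<cdot> \<p> A = x' \<cdot> \<p> A" "y \<cdot> \<p> B = y' \<cdot> \<p> B" "A \<in> Ob X" "B \<in> Ob X"
  shows "\<langle>tplus X A x x', tplus X B y y'\<rangle> \<cdot> \<alpha> A B =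
    tplus X (A \<Otimes> B) (\<langle>x, y\<rangle> \<cdot> \<alpha> A B) (\<langle>x', y'\<rangle> \<cdot> \<alpha> A B)"
proof -
  note [simp] = assms(1-11,14,15)
  let ?x = "bpair X (tbundle X A) x x'" and ?y = "bpair X (tbundle X B) y y'"
  have x [simp]: "?x \<in> Ar X" "src X ?x = src X x" "tgt X ?x = \<T>\<^sub>2 A" "?x \<cdot> \<pi>\<^sub>0 A = x" "?x \<cdot> \<pi>\<^sub>1 A = x'"
    using bpair_props[of x x' A] assms by simp_all
  have y [simp]: "?y \<in> Ar X" "src X ?y = src X x" "tgt X ?y = \<T>\<^sub>2 B" "?y \<cdot> \<pi>\<^sub>0 B = y" "?y \<cdot> \<pi>\<^sub>1 B = y'"
    using bpair_props[of y y' B] assms by simp_all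
  have *: "(\<pi>\<^sub>0 A \<otimes> \<pi>\<^sub>0 B) \<cdot> \<alpha> A B \<cdot> \<p> (A \<Otimes> B) = (\<pi>\<^sub>1 A \<otimes> \<pi>\<^sub>1 B) \<cdot> \<alpha> A B \<cdot> \<p> (A \<Otimes> B)"
    by (simp add: Tprod_proj cross_def)
  have "\<langle>tplus X A x x', tplus X B y y'\<rangle> \<cdot> \<alpha> A B = \<langle>?x, ?y\<rangle> \<cdot> ((\<oplus> A \<otimes> \<oplus> B) \<cdot> \<alpha> A B)"
    unfolding tplus_def
    using comp_assoc'[of "\<langle>?x, ?y\<rangle>" "\<oplus> A \<otimes> \<oplus> B" "\<alpha> A B"] by (simp add: pair_comp_cross)
  also have "\<dots> = \<langle>?x, ?y\<rangle> \<cdot>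
      tplus X (A \<Otimes> B) ((\<pi>\<^sub>0 A \<otimes> \<pi>\<^sub>0 B) \<cdot> \<alpha> A B) ((\<pi>\<^sub>1 A \<otimes> \<pi>\<^sub>1 B) \<cdot> \<alpha> A B)"
    by (simp add: Tprod_add tplus_def)
  also have "\<dots> = tplus X (A \<Otimes> B)
      (\<langle>?x, ?y\<rangle> \<cdot> ((\<pi>\<^sub>0 A \<otimes> \<pi>\<^sub>0 B) \<cdot> \<alpha> A B)) (\<langle>?x, ?y\<rangle> \<cdot> ((\<pi>\<^sub>1 A \<otimes> \<pi>\<^sub>1 B) \<cdot> \<alpha> A B))"
    by (rule comp_tplus) (use * in simp_all)
  also have "\<langle>?x, ?y\<rangle> \<cdot> ((\<pi>\<^sub>0 A \<otimes> \<pi>\<^sub>0 B) \<cdot> \<alpha> A B) = \<langle>x, y\<rangle> \<cdot> \<alpha> A B"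
    using comp_assoc'[of "\<langle>?x, ?y\<rangle>" "\<pi>\<^sub>0 A \<otimes> \<pi>\<^sub>0 B" "\<alpha> A B"] by (simp add: pair_comp_cross)
  also have "\<langle>?x, ?y\<rangle> \<cdot> ((\<pi>\<^sub>1 A \<otimes> \<pi>\<^sub>1 B) \<cdot> \<alpha> A B) = \<langle>x', y'\<rangle> \<cdot> \<alpha> A B"
    using comp_assoc'[of "\<langle>?x, ?y\<rangle>" "\<pi>\<^sub>1 A \<otimes> \<pi>\<^sub>1 B" "\<alpha> A B"] by (simp add: pair_comp_cross)
  finally show ?thesis .
qed

end

section \<open>Multiplication of generalized elements\<close>

context group_object
begin

definition gmul :: "'a \<Rightarrow> 'a \<Rightarrow> 'a" (infixl "\<star>" 73) where
  "a \<star> b = \<langle>a, b\<rangle> \<cdot> m"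

definition Tmul :: "'a \<Rightarrow> 'a \<Rightarrow> 'a" (infixl "\<bullet>" 73) where
  "x \<bullet> y = \<langle>x, y\<rangle> \<cdot> \<alpha> G G \<cdot> \<T>\<^sub>a m"

lemma structure_Ar [simp]:
  shows "m \<in> Ar X" "src X m = G \<Otimes> G" "tgt X m = G"
    "u \<in> Ar X" "src X u = \<I>" "tgt X u = G"
    "\<iota> \<in> Ar X" "src X \<iota> = G" "tgt X \<iota> = G"
    "G \<in> Ob X"
  using mult unit inv carrier by (auto simp: hom_def)

lemma gmul_Ar [simp]:
  assumes "a \<in> Ar X" "b \<in> Ar X" "src X a = src X b" "tgt X a = G" "tgt X b = G"
  shows "a \<star> b \<in> Ar X" "src X (a \<star> b) = src X a" "tgt X (a \<star> b) = G"
  using assms by (simp_all add: gmul_def)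

lemma comp_gmul [simp]:
  assumes "a \<in> Ar X" "b \<in> Ar X" "src X a = src X b" "tgt X a = G" "tgt X b = G"
    "h \<in> Ar X" "tgt X h = src X a"
  shows "h \<cdot> (a \<star> b) = (h \<cdot> a) \<star> (h \<cdot> b)"
  using assms comp_assoc'[of h "\<langle>a, b\<rangle>" m] by (simp add: gmul_def)

lemma gmul_assoc:
  assumes "a \<in> Ar X" "b \<in> Ar X" "c \<in> Ar X" "src X b = src X a" "src X c = src X a"
    "tgt X a = G" "tgt X b = G" "tgt X c = G"
  shows "a \<star> b \<star> c = a \<star> (b \<star> c)"
proof -
  note [simp] = assms
  let ?w = "\<langle>\<langle>a, b\<rangle>, c\<rangle>"
  have "a \<star> b \<star> c = ?w \<cdot> ((m \<otimes> \<one> G) \<cdot> m)"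
    using comp_assoc'[of ?w "m \<otimes> \<one> G" m] by (simp add: gmul_def pair_comp_cross)
  also have "\<dots> = \<langle>a, \<langle>b, c\<rangle>\<rangle> \<cdot> ((\<one> G \<otimes> m) \<cdot> m)"
    unfolding mult_assoc
    using comp_assoc'[of ?w "\<langle>pfst X (G \<Otimes> G) G \<cdot> pfst X G G,
        \<langle>pfst X (G \<Otimes> G) G \<cdot> psnd X G G, psnd X (G \<Otimes> G) G\<rangle>\<rangle>" "(\<one> G \<otimes> m) \<cdot> m"]
    by simp
  also have "\<dots> = a \<star> (b \<star> c)"
    using comp_assoc'[of "\<langle>a, \<langle>b, c\<rangle>\<rangle>" "\<one> G \<otimes> m" m] by (simp add: gmul_def pair_comp_cross)
  finally show ?thesis .
qed

lemma gmul_unit_left [simp]: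
  assumes "a \<in> Ar X" "tgt X a = G" "src X a = Y"
  shows "(! Y \<cdot> u) \<star> a = a"
proof -
  have "a \<cdot> ((! G \<cdot> u) \<star> \<one> G) = a"
    using unit_left assms by (simp add: gmul_def)
  moreover have "a \<cdot> (! G \<cdot> u) = ! Y \<cdot> u"
    using assms comp_assoc'[of a "! G" u] by simp
  ultimately show ?thesis using assms by simp
qed

lemma gmul_unit_right [simp]:
  assumes "a \<in> Ar X" "tgt X a = G" "src X a = Y"
  shows "a \<star> (! Y \<cdot> u) = a"
proof -
  have "a \<cdot> (\<one> G \<star> (! G \<cdot> u)) = a"
    using unit_right assms by (simp add: gmul_def)
  moreover have "a \<cdot> (! G \<cdot> u) = ! Y \<cdot> u"
    using assms comp_assoc'[of a "! G" u] by simp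
  ultimately show ?thesis using assms by simp
qed

lemma gmul_inverse:
  assumes "a \<in> Ar X" "tgt X a = G" "src X a = Y"
  shows "(a \<cdot> \<iota>) \<star> a = ! Y \<cdot> u" "a \<star> (a \<cdot> \<iota>) = ! Y \<cdot> u"
proof -
  have e: "a \<cdot> (! G \<cdot> u) = ! Y \<cdot> u"
    using assms comp_assoc'[of a "! G" u] by simp
  have "a \<cdot> (\<iota> \<star> \<one> G) = ! Y \<cdot> u" "a \<cdot> (\<one> G \<star> \<iota>) = ! Y \<cdot> u"
    using inv_left inv_right e by (simp_all add: gmul_def)
  then show "(a \<cdot> \<iota>) \<star> a = ! Y \<cdot> u" "a \<star> (a \<cdot> \<iota>) = ! Y \<cdot> u"
    using assms by simp_all
qed

lemma Tmul_Ar [simp]: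
  assumes "x \<in> Ar X" "y \<in> Ar X" "src X x = src X y" "tgt X x = \<T>\<^sub>o G" "tgt X y = \<T>\<^sub>o G"
  shows "x \<bullet> y \<in> Ar X" "src X (x \<bullet> y) = src X x" "tgt X (x \<bullet> y) = \<T>\<^sub>o G"
  using assms by (simp_all add: Tmul_def)

lemma comp_Tmul:
  assumes "x \<in> Ar X" "y \<in> Ar X" "src X x = src X y" "tgt X x = \<T>\<^sub>o G" "tgt X y = \<T>\<^sub>o G"
    "h \<in> Ar X" "tgt X h = src X x"
  shows "h \<cdot> (x \<bullet> y) = (h \<cdot> x) \<bullet> (h \<cdot> y)"
  using assms comp_assoc'[of h "\<langle>x, y\<rangle>" "\<alpha> G G \<cdot> \<T>\<^sub>a m"] by (simp add: Tmul_def)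

text \<open>
  For fixed \<open>w : Y \<rightarrow> T W\<close> the assignment \<open>a \<mapsto> w T(a)\<close> turns products of arrows \<open>W \<rightarrow> G\<close> into
  products of arrows \<open>Y \<rightarrow> T G\<close>.  An equational law of \<open>G\<close> therefore passes to \<open>T G\<close> once the
  given vectors are written as \<open>w T(a)\<close> for a common \<open>w\<close>.
\<close>

lemma Tmul_T:
  assumes "w \<in> Ar X" "a \<in> Ar X" "b \<in> Ar X" "src X b = src X a" "tgt X w = \<T>\<^sub>o (src X a)"
    "tgt X a = G" "tgt X b = G"
  shows "(w \<cdot> \<T>\<^sub>a a) \<bullet> (w \<cdot> \<T>\<^sub>a b) = w \<cdot> \<T>\<^sub>a (a \<star> b)"
  using assms by (simp add: Tmul_def gmul_def T_pair del: comp_assoc') simp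

text \<open>
  Here \<open>w\<close> is the triple of the given vectors, seen as a vector of \<open>(G \<times> G) \<times> G\<close>, and
  \<open>a\<close>, \<open>b\<close>, \<open>c\<close> are the three projections.
\<close>

lemma Tmul_assoc:
  assumes "x \<in> Ar X" "y \<in> Ar X" "z \<in> Ar X" "src X y = src X x" "src X z = src X x"
    "tgt X x = \<T>\<^sub>o G" "tgt X y = \<T>\<^sub>o G" "tgt X z = \<T>\<^sub>o G"
  shows "x \<bullet> y \<bullet> z = x \<bullet> (y \<bullet> z)"
proof -
  note [simp] = assms
  define v where "v = \<langle>x, y\<rangle> \<cdot> \<alpha> G G"
  define w where "w = \<langle>v, z\<rangle> \<cdot> \<alpha> (G \<Otimes> G) G"
  define a where "a = pfst X (G \<Otimes> G) G \<cdot> pfst X G G"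
  define b where "b = pfst X (G \<Otimes> G) G \<cdot> psnd X G G"
  define c where "c = psnd X (G \<Otimes> G) G"
  have [simp]: "v \<in> Ar X" "src X v = src X x" "tgt X v = \<T>\<^sub>o (G \<Otimes> G)" by (simp_all add: v_def)
  have [simp]: "w \<in> Ar X" "src X w = src X x" "tgt X w = \<T>\<^sub>o ((G \<Otimes> G) \<Otimes> G)" by (simp_all add: w_def)
  have [simp]: "a \<in> Ar X" "src X a = (G \<Otimes> G) \<Otimes> G" "tgt X a = G"
    "b \<in> Ar X" "src X b = (G \<Otimes> G) \<Otimes> G" "tgt X b = G"
    "c \<in> Ar X" "src X c = (G \<Otimes> G) \<Otimes> G" "tgt X c = G" by (simp_all add: a_def b_def c_def)
  have v: "w \<cdot> \<T>\<^sub>a (pfst X (G \<Otimes> G) G) = v" and z: "z = w \<cdot> \<T>\<^sub>a c"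
    unfolding w_def c_def by (simp_all only: alpha_proj assms structure_Ar proj_Ar
        \<open>v \<in> Ar X\<close> \<open>src X v = src X x\<close> \<open>tgt X v = \<T>\<^sub>o (G \<Otimes> G)\<close>)
  have xy: "v \<cdot> \<T>\<^sub>a (pfst X G G) = x" "v \<cdot> \<T>\<^sub>a (psnd X G G) = y"
    unfolding v_def by (simp_all only: alpha_proj assms structure_Ar)
  have x: "x = w \<cdot> \<T>\<^sub>a a"
    using comp_assoc'[of w "\<T>\<^sub>a (pfst X (G \<Otimes> G) G)" "\<T>\<^sub>a (pfst X G G)"] by (simp add: a_def v xy)
  have y: "y = w \<cdot> \<T>\<^sub>a b"
    using comp_assoc'[of w "\<T>\<^sub>a (pfst X (G \<Otimes> G) G)" "\<T>\<^sub>a (psnd X G G)"] by (simp add: b_def v xy)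
  have "x \<bullet> y \<bullet> z = w \<cdot> \<T>\<^sub>a (a \<star> b \<star> c)"
    unfolding x y z by (simp add: Tmul_T)
  also have "a \<star> b \<star> c = a \<star> (b \<star> c)" by (rule gmul_assoc) simp_all
  also have "w \<cdot> \<T>\<^sub>a (a \<star> (b \<star> c)) = x \<bullet> (y \<bullet> z)"
    unfolding x y z by (simp add: Tmul_T)
  finally show ?thesis .
qed

text \<open>
  Transport along \<open>w = x\<close> of the unit law \<open>(!u)1 = 1\<close> in the arrows \<open>G \<rightarrow> G\<close>.
\<close>

lemma Tmul_unit_left:
  assumes "x \<in> Ar X" "src X x = Y" "tgt X x = \<T>\<^sub>o G"
  shows "(! Y \<cdot> u \<cdot> \<zero> G) \<bullet> x = x"
proof -
  have "(x \<cdot> \<T>\<^sub>a (! G \<cdot> u)) \<bullet> (x \<cdot> \<T>\<^sub>a (\<one> G)) = x \<cdot> \<T>\<^sub>a ((! G \<cdot> u) \<star> \<one> G)"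
    by (rule Tmul_T) (use assms in simp_all)
  then show ?thesis
    using T_bang[of x G u G] assms by (simp del: comp_assoc' T_comp)
qed

lemma Tmul_p:
  assumes "x \<in> Ar X" "y \<in> Ar X" "src X x = src X y" "tgt X x = \<T>\<^sub>o G" "tgt X y = \<T>\<^sub>o G"
  shows "(x \<bullet> y) \<cdot> \<p> G = (x \<cdot> \<p> G) \<star> (y \<cdot> \<p> G)"
proof -
  note [simp] = assms
  have "(x \<bullet> y) \<cdot> \<p> G = \<langle>x, y\<rangle> \<cdot> \<alpha> G G \<cdot> \<p> (G \<Otimes> G) \<cdot> m"
    by (simp add: Tmul_def p_natural)
  also have "\<langle>x, y\<rangle> \<cdot> \<alpha> G G \<cdot> \<p> (G \<Otimes> G) = \<langle>x \<cdot> \<p> G, y \<cdot> \<p> G\<rangle>" by (rule alpha_p) simp_all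
  finally show ?thesis by (simp add: gmul_def)
qed

lemma Tmul_zero:
  assumes "a \<in> Ar X" "b \<in> Ar X" "src X a = src X b" "tgt X a = G" "tgt X b = G"
  shows "(a \<cdot> \<zero> G) \<bullet> (b \<cdot> \<zero> G) = (a \<star> b) \<cdot> \<zero> G"
proof -
  note [simp] = assms
  have "(a \<cdot> \<zero> G) \<bullet> (b \<cdot> \<zero> G) = \<langle>a, b\<rangle> \<cdot> \<zero> (G \<Otimes> G) \<cdot> \<T>\<^sub>a m"
    unfolding Tmul_def by (simp only: alpha_zero assms)
  also have "\<dots> = (a \<star> b) \<cdot> \<zero> G" by (simp add: gmul_def zero_natural)
  finally show ?thesis .
qed

text \<open>
  Addition commutes with \<open>\<alpha>\<close> by \<open>alpha_add\<close> and with \<open>T(m)\<close> by naturality.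
\<close>

lemma Tmul_add:
  assumes "x \<in> Ar X" "x' \<in> Ar X" "y \<in> Ar X" "y' \<in> Ar X"
    "src X x' = src X x" "src X y = src X x" "src X y' = src X x"
    "tgt X x = \<T>\<^sub>o G" "tgt X x' = \<T>\<^sub>o G" "tgt X y = \<T>\<^sub>o G" "tgt X y' = \<T>\<^sub>o G"
    "x \<cdot> \<p> G = x' \<cdot> \<p> G" "y \<cdot> \<p> G = y' \<cdot> \<p> G"
  shows "tplus X G x x' \<bullet> tplus X G y y' = tplus X G (x \<bullet> y) (x' \<bullet> y')"
proof -
  note [simp] = assms(1-11)
  have "tplus X G x x' \<bullet> tplus X G y y' =
      tplus X (G \<Otimes> G) (\<langle>x, y\<rangle> \<cdot> \<alpha> G G) (\<langle>x', y'\<rangle> \<cdot> \<alpha> G G) \<cdot> \<T>\<^sub>a m"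
    unfolding Tmul_def by (subst alpha_add) (use assms in simp_all)
  also have "\<dots> = tplus X G (x \<bullet> y) (x' \<bullet> y')"
    unfolding Tmul_def
  proof (rule tplus_T)
    show "\<langle>x, y\<rangle> \<cdot> \<alpha> G G \<cdot> \<p> (G \<Otimes> G) = \<langle>x', y'\<rangle> \<cdot> \<alpha> G G \<cdot> \<p> (G \<Otimes> G)"
      using alpha_p[of x y G G] alpha_p[of x' y' G G] assms(12,13) by simp
  qed simp_all
  finally show ?thesis .
qed

end


section \<open>Trivialising the tangent bundle by left translation\<close>

locale tangent_space_at_unit = group_object X G m u \<iota>
  for X :: "('o, 'a, 'x) cartesian_tangent_category_scheme" (structure)
    and G m u \<iota> +
  fixes Gu pu
  assumes tangent_space: "is_pullback X u (\<p> G) Gu (! Gu) pu"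
begin

abbreviation "add_Gu \<equiv> add_u X G Gu pu"
abbreviation "zero_Gu \<equiv> zero_u X G u Gu pu"
abbreviation "\<psi> \<equiv> phi_inv X G m pu"

lemma Gu_Ar [simp]:
  "Gu \<in> Ob X" "pu \<in> Ar X" "src X pu = Gu" "tgt X pu = \<T>\<^sub>o G" "pu \<cdot> \<p> G = ! Gu \<cdot> u"
  using tangent_space src_ob[of pu] by (auto simp: is_pullback_def hom_def)

lemma pu_mono:
  assumes "k \<in> Ar X" "k' \<in> Ar X" "src X k = src X k'" "tgt X k = Gu" "tgt X k' = Gu"
    "k \<cdot> pu = k' \<cdot> pu"
  shows "k = k'"
proof (rule pullback_ext[OF tangent_space _ _ _ assms(6)])
  show "k \<in> hom X (src X k) Gu" "k' \<in> hom X (src X k) Gu"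
    using assms by (simp_all add: hom_def)
  show "k \<cdot> ! Gu = k' \<cdot> ! Gu" using assms by simp
qed

lemma ulift_props:
  assumes "h \<in> Ar X" "tgt X h = \<T>\<^sub>o G" "src X h = Y" "h \<cdot> \<p> G = ! Y \<cdot> u"
  shows "ulift X Gu pu h \<in> Ar X" "src X (ulift X Gu pu h) = Y" "tgt X (ulift X Gu pu h) = Gu"
    "ulift X Gu pu h \<cdot> pu = h"
proof -
  have [simp]: "Y \<in> Ob X" using assms by auto
  have "\<exists>!k. k \<in> hom X (src X h) Gu \<and> k \<cdot> ! Gu = ! Y \<and> k \<cdot> pu = h"
    by (rule pullback_ex1[OF tangent_space]) (use assms in \<open>simp_all add: hom_def\<close>)
  then obtain k where k: "k \<in> hom X (src X h) Gu" "k \<cdot> pu = h" by blast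
  have "\<exists>!k. k \<in> hom X (src X h) Gu \<and> k \<cdot> pu = h"
  proof (rule ex1I[of _ k])
    fix k' assume "k' \<in> hom X (src X h) Gu \<and> k' \<cdot> pu = h"
    with k show "k' = k" by - (rule pu_mono, simp_all add: hom_def)
  qed (use k in simp)
  from theI'[OF this]
  show "ulift X Gu pu h \<in> Ar X" "src X (ulift X Gu pu h) = Y" "tgt X (ulift X Gu pu h) = Gu"
    "ulift X Gu pu h \<cdot> pu = h"
    using assms by (auto simp: ulift_def hom_def)
qed

lemma zero_Gu_props [simp]:
  "zero_Gu \<in> Ar X" "src X zero_Gu = \<I>" "tgt X zero_Gu = Gu" "zero_Gu \<cdot> pu = u \<cdot> \<zero> G"
  unfolding zero_u_def using ulift_props[of "u \<cdot> \<zero> G" \<I>] by simp_all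

lemma comp_pu_p:
  assumes "v \<in> Ar X" "tgt X v = Gu"
  shows "v \<cdot> (pu \<cdot> \<p> G) = ! (src X v) \<cdot> u"
  using assms comp_assoc'[of v "! Gu" u] by simp

lemma add_Gu_props:
  shows "add_Gu \<in> Ar X" "src X add_Gu = Gu \<Otimes> Gu" "tgt X add_Gu = Gu"
    "add_Gu \<cdot> pu = tplus X G (pfst X Gu Gu \<cdot> pu) (psnd X Gu Gu \<cdot> pu)"
proof -
  have e: "pfst X Gu Gu \<cdot> pu \<cdot> \<p> G = psnd X Gu Gu \<cdot> pu \<cdot> \<p> G"
    by (simp add: comp_pu_p del: Gu_Ar(5))
  note P = tplus_props[OF _ _ _ _ _ e]
  have "tplus X G (pfst X Gu Gu \<cdot> pu) (psnd X Gu Gu \<cdot> pu) \<cdot> \<p> G = ! (Gu \<Otimes> Gu) \<cdot> u"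
    by (subst P(4)) (simp_all add: comp_pu_p del: Gu_Ar(5))
  then show "add_Gu \<in> Ar X" "src X add_Gu = Gu \<Otimes> Gu" "tgt X add_Gu = Gu"
    "add_Gu \<cdot> pu = tplus X G (pfst X Gu Gu \<cdot> pu) (psnd X Gu Gu \<cdot> pu)"
    using ulift_props[of "tplus X G (pfst X Gu Gu \<cdot> pu) (psnd X Gu Gu \<cdot> pu)" "Gu \<Otimes> Gu"] P
    by (simp_all add: add_u_def tplus_def)
qed

lemma phi_inv_Ar [simp]: "\<psi> \<in> Ar X" "src X \<psi> = G \<Otimes> Gu" "tgt X \<psi> = \<T>\<^sub>o G"
  by (simp_all add: phi_inv_def)

text \<open>
  All four squares are obtained by evaluating this description of \<open>\<psi> = \<phi>\<^sup>-\<^sup>1\<close>: left translation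
  of \<open>v\<close> from the unit to the point \<open>a\<close>.
\<close>

lemma pair_phi_inv:
  assumes "a \<in> Ar X" "v \<in> Ar X" "src X a = src X v" "tgt X a = G" "tgt X v = Gu"
  shows "\<langle>a, v\<rangle> \<cdot> \<psi> = (a \<cdot> \<zero> G) \<bullet> (v \<cdot> pu)"
proof -
  note [simp] = assms
  have "\<langle>a, v\<rangle> \<cdot> \<psi> = \<langle>a, v\<rangle> \<cdot> (\<zero> G \<otimes> pu) \<cdot> \<alpha> G G \<cdot> \<T>\<^sub>a m"
    by (simp add: phi_inv_def)
  also have "\<langle>a, v\<rangle> \<cdot> (\<zero> G \<otimes> pu) = \<langle>a \<cdot> \<zero> G, v \<cdot> pu\<rangle>" by (simp add: pair_comp_cross)
  finally show ?thesis by (simp add: Tmul_def)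
qed

lemma phi_inv_eq: "\<psi> = (pfst X G Gu \<cdot> \<zero> G) \<bullet> (psnd X G Gu \<cdot> pu)"
proof -
  have "\<langle>pfst X G Gu, psnd X G Gu\<rangle> = \<one> (G \<Otimes> Gu)"
    by (rule prod_ext[where A = G and B = Gu]) simp_all
  then show ?thesis using pair_phi_inv[of "pfst X G Gu" "psnd X G Gu"] by simp
qed

lemma pair_phi_inv_p:
  assumes "a \<in> Ar X" "v \<in> Ar X" "src X a = src X v" "tgt X a = G" "tgt X v = Gu"
  shows "\<langle>a, v\<rangle> \<cdot> \<psi> \<cdot> \<p> G = a"
  unfolding pair_phi_inv[OF assms] using assms
  by (simp add: Tmul_p comp_pu_p del: Gu_Ar(5))

lemma phi_inv_p: "\<psi> \<cdot> \<p> G = pfst X G Gu"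
  unfolding phi_inv_eq by (simp add: Tmul_p comp_pu_p del: Gu_Ar(5))

text \<open>
  The Maurer--Cartan form of \<open>G\<close>: a vector at \<open>a\<close> is translated back to the unit by
  \<open>a\<^sup>-\<^sup>1\<close>.  With \<open>p\<close> it constitutes the inverse of \<open>\<psi>\<close>.
\<close>

definition maurer_cartan :: 'a where
  "maurer_cartan = ulift X Gu pu ((\<p> G \<cdot> \<iota> \<cdot> \<zero> G) \<bullet> \<one> (\<T>\<^sub>o G))"

lemma maurer_cartan_props [simp]:
  "maurer_cartan \<in> Ar X" "src X maurer_cartan = \<T>\<^sub>o G" "tgt X maurer_cartan = Gu"
  "maurer_cartan \<cdot> pu = (\<p> G \<cdot> \<iota> \<cdot> \<zero> G) \<bullet> \<one> (\<T>\<^sub>o G)"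
proof -
  have "((\<p> G \<cdot> \<iota> \<cdot> \<zero> G) \<bullet> \<one> (\<T>\<^sub>o G)) \<cdot> \<p> G = ! (\<T>\<^sub>o G) \<cdot> u"
    by (simp add: Tmul_p gmul_inverse)
  then show "maurer_cartan \<in> Ar X" "src X maurer_cartan = \<T>\<^sub>o G" "tgt X maurer_cartan = Gu"
    "maurer_cartan \<cdot> pu = (\<p> G \<cdot> \<iota> \<cdot> \<zero> G) \<bullet> \<one> (\<T>\<^sub>o G)"
    unfolding maurer_cartan_def
    using ulift_props[of "(\<p> G \<cdot> \<iota> \<cdot> \<zero> G) \<bullet> \<one> (\<T>\<^sub>o G)" "\<T>\<^sub>o G"] by simp_all
qed

lemma comp_maurer_cartan_pu:
  assumes "x \<in> Ar X" "tgt X x = \<T>\<^sub>o G"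
  shows "x \<cdot> maurer_cartan \<cdot> pu = (x \<cdot> \<p> G \<cdot> \<iota> \<cdot> \<zero> G) \<bullet> x"
  using assms by (simp add: comp_Tmul)

lemma cancel_translation:
  assumes "a \<in> Ar X" "b \<in> Ar X" "x \<in> Ar X" "src X a = Y" "src X b = Y" "src X x = Y"
    "tgt X a = G" "tgt X b = G" "tgt X x = \<T>\<^sub>o G" "a \<star> b = ! Y \<cdot> u"
  shows "(a \<cdot> \<zero> G) \<bullet> ((b \<cdot> \<zero> G) \<bullet> x) = x"
proof -
  have "(a \<cdot> \<zero> G) \<bullet> ((b \<cdot> \<zero> G) \<bullet> x) = (a \<cdot> \<zero> G) \<bullet> (b \<cdot> \<zero> G) \<bullet> x"
    by (rule Tmul_assoc[symmetric]) (use assms in simp_all)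
  also have "(a \<cdot> \<zero> G) \<bullet> (b \<cdot> \<zero> G) = (a \<star> b) \<cdot> \<zero> G"
    by (rule Tmul_zero) (use assms in simp_all)
  also have "((a \<star> b) \<cdot> \<zero> G) \<bullet> x = x"
    unfolding assms(10) by (rule Tmul_unit_left) (use assms in simp_all)
  finally show ?thesis .
qed

lemma translate_maurer_cartan:
  assumes "x \<in> Ar X" "tgt X x = \<T>\<^sub>o G"
  shows "\<langle>x \<cdot> \<p> G, x \<cdot> maurer_cartan\<rangle> \<cdot> \<psi> = x"
proof -
  note [simp] = assms
  have "\<langle>x \<cdot> \<p> G, x \<cdot> maurer_cartan\<rangle> \<cdot> \<psi> = (x \<cdot> \<p> G \<cdot> \<zero> G) \<bullet> (x \<cdot> maurer_cartan \<cdot> pu)"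
    by (rule pair_phi_inv) simp_all
  also have "\<dots> = (x \<cdot> \<p> G \<cdot> \<zero> G) \<bullet> ((x \<cdot> \<p> G \<cdot> \<iota> \<cdot> \<zero> G) \<bullet> x)"
    by (simp only: comp_maurer_cartan_pu assms)
  also have "\<dots> = x"
    by (rule cancel_translation[where Y = "src X x"])
      (use gmul_inverse[of "x \<cdot> \<p> G"] in \<open>simp_all\<close>)
  finally show ?thesis .
qed

lemma maurer_cartan_translate:
  assumes "a \<in> Ar X" "v \<in> Ar X" "src X a = src X v" "tgt X a = G" "tgt X v = Gu"
  shows "\<langle>a, v\<rangle> \<cdot> \<psi> \<cdot> maurer_cartan = v"
proof (rule pu_mono)
  note [simp] = assms
  have p: "\<langle>a, v\<rangle> \<cdot> \<psi> \<cdot> \<p> G = a" by (rule pair_phi_inv_p) simp_all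
  have "\<langle>a, v\<rangle> \<cdot> \<psi> \<cdot> maurer_cartan \<cdot> pu = (a \<cdot> \<iota> \<cdot> \<zero> G) \<bullet> (\<langle>a, v\<rangle> \<cdot> \<psi>)"
    using comp_maurer_cartan_pu[of "\<langle>a, v\<rangle> \<cdot> \<psi>"] unfolding p by simp
  also have "\<dots> = (a \<cdot> \<iota> \<cdot> \<zero> G) \<bullet> ((a \<cdot> \<zero> G) \<bullet> (v \<cdot> pu))"
    by (simp only: pair_phi_inv assms)
  also have "(a \<cdot> \<iota> \<cdot> \<zero> G) \<bullet> ((a \<cdot> \<zero> G) \<bullet> (v \<cdot> pu)) = v \<cdot> pu"
    by (rule cancel_translation[where Y = "src X v"]) (simp_all add: gmul_inverse)
  finally show "\<langle>a, v\<rangle> \<cdot> \<psi> \<cdot> maurer_cartan \<cdot> pu = v \<cdot> pu" .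
qed (use assms in simp_all)

lemma phi_inv_iso: "is_iso X \<psi>"
proof (rule is_isoI)
  show "\<psi> \<in> hom X (G \<Otimes> Gu) (\<T>\<^sub>o G)" "\<langle>\<p> G, maurer_cartan\<rangle> \<in> hom X (\<T>\<^sub>o G) (G \<Otimes> Gu)"
    by (simp_all add: hom_def)
  show "\<langle>\<p> G, maurer_cartan\<rangle> \<cdot> \<psi> = \<one> (\<T>\<^sub>o G)"
    using translate_maurer_cartan[of "\<one> (\<T>\<^sub>o G)"] by simp
  have e: "\<langle>pfst X G Gu, psnd X G Gu\<rangle> = \<one> (G \<Otimes> Gu)"
    by (rule prod_ext[where A = G and B = Gu]) simp_all
  have "\<psi> \<cdot> maurer_cartan = psnd X G Gu"
    using maurer_cartan_translate[of "pfst X G Gu" "psnd X G Gu"] by (simp add: e)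
  then show "\<psi> \<cdot> \<langle>\<p> G, maurer_cartan\<rangle> = \<one> (G \<Otimes> Gu)"
    by (simp add: phi_inv_p e)
qed

lemma zero_eq_translate: "\<langle>\<one> G, ! G \<cdot> zero_Gu\<rangle> \<cdot> \<psi> = \<zero> G"
proof -
  have "\<langle>\<one> G, ! G \<cdot> zero_Gu\<rangle> \<cdot> \<psi> = (\<one> G \<cdot> \<zero> G) \<bullet> (! G \<cdot> u \<cdot> \<zero> G)"
    by (subst pair_phi_inv) simp_all
  also have "\<dots> = (\<one> G \<star> (! G \<cdot> u)) \<cdot> \<zero> G"
    by (rule Tmul_zero) simp_all
  finally show ?thesis by simp
qed

lemma unit_eq_translate: "\<langle>u, zero_Gu\<rangle> \<cdot> \<psi> = \<zero> \<I> \<cdot> \<T>\<^sub>a u"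
proof -
  have "\<langle>u, zero_Gu\<rangle> = u \<cdot> \<langle>\<one> G, ! G \<cdot> zero_Gu\<rangle>"
    using comp_assoc'[of u "! G" zero_Gu] by simp
  then have "\<langle>u, zero_Gu\<rangle> \<cdot> \<psi> = u \<cdot> (\<langle>\<one> G, ! G \<cdot> zero_Gu\<rangle> \<cdot> \<psi>)"
    by (simp del: comp_pair)
  then show ?thesis by (simp add: zero_eq_translate zero_natural)
qed

text \<open>
  The square for addition on generalized elements: as \<open>a0 = a0 + a0\<close>, the common factor can be pulled out of
  the sum by \<open>Tmul_add\<close>.
\<close>

lemma add_translate:
  assumes "a \<in> Ar X" "v \<in> Ar X" "w \<in> Ar X" "src X v = src X a" "src X w = src X a"
    "tgt X a = G" "tgt X v = Gu" "tgt X w = Gu"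
  shows "tplus X G (\<langle>a, v\<rangle> \<cdot> \<psi>) (\<langle>a, w\<rangle> \<cdot> \<psi>) = \<langle>a, \<langle>v, w\<rangle> \<cdot> add_Gu\<rangle> \<cdot> \<psi>"
proof -
  note [simp] = assms add_Gu_props(1-3)
  have p: "v \<cdot> pu \<cdot> \<p> G = w \<cdot> pu \<cdot> \<p> G" by (simp add: comp_pu_p del: Gu_Ar(5))
  have q: "pfst X Gu Gu \<cdot> pu \<cdot> \<p> G = psnd X Gu Gu \<cdot> pu \<cdot> \<p> G"
    by (simp add: comp_pu_p del: Gu_Ar(5))
  have sum: "\<langle>v, w\<rangle> \<cdot> add_Gu \<cdot> pu = tplus X G (v \<cdot> pu) (w \<cdot> pu)"
    using comp_tplus[OF _ _ _ _ _ _ _ q, of "\<langle>v, w\<rangle>"] by (simp add: add_Gu_props(4))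
  have "tplus X G (\<langle>a, v\<rangle> \<cdot> \<psi>) (\<langle>a, w\<rangle> \<cdot> \<psi>) =
      tplus X G ((a \<cdot> \<zero> G) \<bullet> (v \<cdot> pu)) ((a \<cdot> \<zero> G) \<bullet> (w \<cdot> pu))"
    by (simp add: pair_phi_inv)
  also have "\<dots> = tplus X G (a \<cdot> \<zero> G) (a \<cdot> \<zero> G) \<bullet> tplus X G (v \<cdot> pu) (w \<cdot> pu)"
    by (rule Tmul_add[symmetric]) (use p in simp_all)
  also have "\<dots> = (a \<cdot> \<zero> G) \<bullet> (\<langle>v, w\<rangle> \<cdot> add_Gu \<cdot> pu)"
    by (simp only: sum tplus_zero assms)
  also have "\<dots> = \<langle>a, \<langle>v, w\<rangle> \<cdot> add_Gu\<rangle> \<cdot> \<psi>"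
    by (rule pair_phi_inv[symmetric]) simp_all
  finally show ?thesis .
qed

abbreviation "\<pi>\<^sub>G \<equiv> pfst X G (Gu \<Otimes> Gu)"
abbreviation "\<pi>\<^sub>v \<equiv> psnd X G (Gu \<Otimes> Gu) \<cdot> pfst X Gu Gu"
abbreviation "\<pi>\<^sub>w \<equiv> psnd X G (Gu \<Otimes> Gu) \<cdot> psnd X Gu Gu"
abbreviation "\<psi>\<^sub>2 \<equiv> phi2_inv X G m Gu pu"

text \<open>
  Pairing into \<open>T\<^sub>2 G\<close> is legitimate because both translates lie over the same point of \<open>G\<close>.
\<close>

lemma phi2_inv_props:
  shows "\<psi>\<^sub>2 \<in> Ar X" "src X \<psi>\<^sub>2 = G \<Otimes> (Gu \<Otimes> Gu)" "tgt X \<psi>\<^sub>2 = \<T>\<^sub>2 G"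
    "\<psi>\<^sub>2 \<cdot> \<pi>\<^sub>0 G = \<langle>\<pi>\<^sub>G, \<pi>\<^sub>v\<rangle> \<cdot> \<psi>" "\<psi>\<^sub>2 \<cdot> \<pi>\<^sub>1 G = \<langle>\<pi>\<^sub>G, \<pi>\<^sub>w\<rangle> \<cdot> \<psi>"
proof -
  have "\<langle>\<pi>\<^sub>G, \<pi>\<^sub>v\<rangle> \<cdot> \<psi> \<cdot> \<p> G = \<pi>\<^sub>G" "\<langle>\<pi>\<^sub>G, \<pi>\<^sub>w\<rangle> \<cdot> \<psi> \<cdot> \<p> G = \<pi>\<^sub>G"
    by (rule pair_phi_inv_p; simp)+
  then have e: "\<langle>\<pi>\<^sub>G, \<pi>\<^sub>v\<rangle> \<cdot> \<psi> \<cdot> \<p> G = \<langle>\<pi>\<^sub>G, \<pi>\<^sub>w\<rangle> \<cdot> \<psi> \<cdot> \<p> G" by simp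
  note P = bpair_props[OF _ _ _ _ _ e]
  have d: "\<psi>\<^sub>2 = bpair X (tbundle X G) (\<langle>\<pi>\<^sub>G, \<pi>\<^sub>v\<rangle> \<cdot> \<psi>) (\<langle>\<pi>\<^sub>G, \<pi>\<^sub>w\<rangle> \<cdot> \<psi>)"
    by (simp add: phi2_inv_def Let_def)
  show "\<psi>\<^sub>2 \<in> Ar X" "src X \<psi>\<^sub>2 = G \<Otimes> (Gu \<Otimes> Gu)" "tgt X \<psi>\<^sub>2 = \<T>\<^sub>2 G"
    "\<psi>\<^sub>2 \<cdot> \<pi>\<^sub>0 G = \<langle>\<pi>\<^sub>G, \<pi>\<^sub>v\<rangle> \<cdot> \<psi>" "\<psi>\<^sub>2 \<cdot> \<pi>\<^sub>1 G = \<langle>\<pi>\<^sub>G, \<pi>\<^sub>w\<rangle> \<cdot> \<psi>"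
    unfolding d using P by simp_all
qed

text \<open>
  Two vectors at a common point correspond to that point and their two translates at the unit.
\<close>

lemma phi2_inv_iso: "is_iso X \<psi>\<^sub>2"
proof (rule is_isoI)
  note [simp] = phi2_inv_props(1-3)
  let ?\<phi> = "\<langle>\<pi>\<^sub>0 G \<cdot> \<p> G, \<langle>\<pi>\<^sub>0 G \<cdot> maurer_cartan, \<pi>\<^sub>1 G \<cdot> maurer_cartan\<rangle>\<rangle>"
  show "\<psi>\<^sub>2 \<in> hom X (G \<Otimes> (Gu \<Otimes> Gu)) (\<T>\<^sub>2 G)" "?\<phi> \<in> hom X (\<T>\<^sub>2 G) (G \<Otimes> (Gu \<Otimes> Gu))"
    by (simp_all add: hom_def)
  have p: "\<psi>\<^sub>2 \<cdot> (\<pi>\<^sub>0 G \<cdot> \<p> G) = \<pi>\<^sub>G"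
    using comp_assoc'[of \<psi>\<^sub>2 "\<pi>\<^sub>0 G" "\<p> G"] pair_phi_inv_p[of \<pi>\<^sub>G \<pi>\<^sub>v]
    by (simp add: phi2_inv_props)
  have v: "\<psi>\<^sub>2 \<cdot> (\<pi>\<^sub>0 G \<cdot> maurer_cartan) = \<pi>\<^sub>v"
    using comp_assoc'[of \<psi>\<^sub>2 "\<pi>\<^sub>0 G" maurer_cartan] maurer_cartan_translate[of \<pi>\<^sub>G \<pi>\<^sub>v]
    by (simp add: phi2_inv_props)
  have w: "\<psi>\<^sub>2 \<cdot> (\<pi>\<^sub>1 G \<cdot> maurer_cartan) = \<pi>\<^sub>w"
    using comp_assoc'[of \<psi>\<^sub>2 "\<pi>\<^sub>1 G" maurer_cartan] maurer_cartan_translate[of \<pi>\<^sub>G \<pi>\<^sub>w]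
    by (simp add: phi2_inv_props)
  have vw: "\<langle>\<pi>\<^sub>v, \<pi>\<^sub>w\<rangle> = psnd X G (Gu \<Otimes> Gu)"
    by (rule prod_ext[where A = Gu and B = Gu]) simp_all
  have "\<psi>\<^sub>2 \<cdot> ?\<phi> = \<langle>\<pi>\<^sub>G, psnd X G (Gu \<Otimes> Gu)\<rangle>"
    by (simp add: p v w vw)
  also have "\<dots> = \<one> (G \<Otimes> (Gu \<Otimes> Gu))"
    by (rule prod_ext[where A = G and B = "Gu \<Otimes> Gu"]) simp_all
  finally show "\<psi>\<^sub>2 \<cdot> ?\<phi> = \<one> (G \<Otimes> (Gu \<Otimes> Gu))" .
  show "?\<phi> \<cdot> \<psi>\<^sub>2 = \<one> (\<T>\<^sub>2 G)"
  proof (rule Tsq_ext[where M = G])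
    have "?\<phi> \<cdot> \<psi>\<^sub>2 \<cdot> \<pi>\<^sub>0 G = ?\<phi> \<cdot> \<langle>\<pi>\<^sub>G, \<pi>\<^sub>v\<rangle> \<cdot> \<psi>"
      by (simp add: phi2_inv_props del: comp_pair)
    also have "\<dots> = \<langle>\<pi>\<^sub>0 G \<cdot> \<p> G, \<pi>\<^sub>0 G \<cdot> maurer_cartan\<rangle> \<cdot> \<psi>" by simp
    finally show "?\<phi> \<cdot> \<psi>\<^sub>2 \<cdot> \<pi>\<^sub>0 G = \<one> (\<T>\<^sub>2 G) \<cdot> \<pi>\<^sub>0 G"
      using translate_maurer_cartan[of "\<pi>\<^sub>0 G"] by simp
    have "?\<phi> \<cdot> \<psi>\<^sub>2 \<cdot> \<pi>\<^sub>1 G = ?\<phi> \<cdot> \<langle>\<pi>\<^sub>G, \<pi>\<^sub>w\<rangle> \<cdot> \<psi>"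
      by (simp add: phi2_inv_props del: comp_pair)
    also have "\<dots> = \<langle>\<pi>\<^sub>0 G \<cdot> \<p> G, \<pi>\<^sub>1 G \<cdot> maurer_cartan\<rangle> \<cdot> \<psi>" by simp
    finally show "?\<phi> \<cdot> \<psi>\<^sub>2 \<cdot> \<pi>\<^sub>1 G = \<one> (\<T>\<^sub>2 G) \<cdot> \<pi>\<^sub>1 G"
      using translate_maurer_cartan[of "\<pi>\<^sub>1 G"] by simp
  qed simp_all
qed

lemma phi2_inv_tadd: "\<psi>\<^sub>2 \<cdot> \<oplus> G = (\<one> G \<otimes> add_Gu) \<cdot> \<psi>"
proof -
  note [simp] = add_Gu_props(1-3)
  have vw: "\<langle>\<pi>\<^sub>v, \<pi>\<^sub>w\<rangle> = psnd X G (Gu \<Otimes> Gu)"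
    by (rule prod_ext[where A = Gu and B = Gu]) simp_all
  have "\<psi>\<^sub>2 \<cdot> \<oplus> G = tplus X G (\<langle>\<pi>\<^sub>G, \<pi>\<^sub>v\<rangle> \<cdot> \<psi>) (\<langle>\<pi>\<^sub>G, \<pi>\<^sub>w\<rangle> \<cdot> \<psi>)"
    by (simp add: phi2_inv_def Let_def tplus_def)
  also have "\<dots> = \<langle>\<pi>\<^sub>G, \<langle>\<pi>\<^sub>v, \<pi>\<^sub>w\<rangle> \<cdot> add_Gu\<rangle> \<cdot> \<psi>"
    by (rule add_translate) simp_all
  also have "\<langle>\<pi>\<^sub>G, \<langle>\<pi>\<^sub>v, \<pi>\<^sub>w\<rangle> \<cdot> add_Gu\<rangle> = \<one> G \<otimes> add_Gu"
    by (simp add: vw cross_def)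
  finally show ?thesis .
qed

end

theorem proposition3:
  fixes X :: "('o, 'a, 'x) cartesian_tangent_category_scheme" (structure)
    and G Gu :: 'o and m u \<iota> pu :: 'a
  assumes "group_object X G m u \<iota>"
    and "is_pullback X u (\<p> G) Gu (! Gu) pu"
  shows
    "(commutative_square X
       (G \<Otimes> (Gu \<Otimes> Gu)) (G \<Otimes> Gu) (\<T>\<^sub>2 G) (\<T>\<^sub>o G)
       (\<one> G \<otimes> add_u X G Gu pu) (phi2_inv X G m Gu pu) (phi_inv X G m pu) (\<oplus> G) \<and>
     is_iso X (phi2_inv X G m Gu pu) \<and> is_iso X (phi_inv X G m pu)) \<and>
    (commutative_square X
       G (G \<Otimes> Gu) G (\<T>\<^sub>o G)
       \<langle>\<one> G, ! G \<cdot> zero_u X G u Gu pu\<rangle> (\<one> G) (phi_inv X G m pu) (\<zero> G) \<and>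
     is_iso X (\<one> G) \<and> is_iso X (phi_inv X G m pu)) \<and>
    (commutative_square X
       (G \<Otimes> Gu) G (\<T>\<^sub>o G) G
       (pfst X G Gu) (phi_inv X G m pu) (\<one> G) (\<p> G) \<and>
     is_iso X (phi_inv X G m pu) \<and> is_iso X (\<one> G)) \<and>
    (commutative_square X
       \<I> (G \<Otimes> Gu) (\<T>\<^sub>o \<I>) (\<T>\<^sub>o G)
       \<langle>u, zero_u X G u Gu pu\<rangle> (\<zero> \<I>) (phi_inv X G m pu) (\<T>\<^sub>a u) \<and>
     is_iso X (\<zero> \<I>) \<and> is_iso X (phi_inv X G m pu))"
proof -
  interpret tangent_space_at_unit X G m u \<iota> Gu pu
    using assms by (simp add: tangent_space_at_unit_def tangent_space_at_unit_axioms_def)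
  note [simp] = add_Gu_props(1-3) phi2_inv_props(1-3)
  have "is_iso X (\<one> G)" by (rule is_isoI[of _ G G "\<one> G"]) (simp_all add: hom_def)
  then show ?thesis
    using phi2_inv_tadd phi2_inv_iso phi_inv_iso zero_eq_translate phi_inv_p
      zero_terminal_iso unit_eq_translate
    by (simp add: commutative_square_def hom_def)
qed

end
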